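(* Let $v:\mathbb{R}_+\to\mathbb{R}_+$ be an admissible weight function, let $X$ be one of the Banach spaces $L^p_v(\mathbb{R}_+)$ (with $1\le p<\infty$) or $C_{0,v}(\mathbb{R}_+)$, and let $\mathcal{T}=\{T_t:t\in\mathbb{R}_+\}$ be the semigroup of left translation operators on $X$. Then $\mathcal{T}$ is hypercyclic if and only if there are some $f\in X$ and some bounded interval $[0,a]\subseteq\mathbb{R}_+$ with $a>0$ such that $\lim_{t\to\infty}\left\|(T_tf)\chi_{[0,a]}\right\|\neq 0$ (that is, $\left\|(T_tf)\chi_{[0,a]}\right\|$ does not converge to $0$ as $t\to\infty$).
   Context: Notation: $\mathbb{R}_+=[0,\infty)$; $\chi_{[0,a]}$ is the characteristic function of $[0,a]$. Admissible weight function: a function $v:\mathbb{R}_+\to\mathbb{R}_+$ that is strictly positive, locally integrable, and such that there exist $M\ge 1$ and $w\in\mathbb{R}_+$ with $v(x)\le Me^{wt}v(x+t)$ for all $x,t\ge 0$. $L^p_v(\mathbb{R}_+)$ is the space of (Lebesgue measurable) $f:\mathbb{R}_+\to\mathbb{R}$ with $\int_0^\infty |f(x)|^pv(x)\,dx<\infty$, functions equal Lebesgue almost everywhere being identified, with norm $\|f\|=\left(\int_0^\infty|f(x)|^pv(x)\,dx\right)^{1/p}$. $C_{0,v}(\mathbb{R}_+)$ is the space of continuous $f:\mathbb{R}_+\to\mathbb{R}$ with $\lim_{x\to\infty}|f(x)|v(x)=0$, with norm $\|f\|=\sup\{|f(x)|v(x):x\in\mathbb{R}_+\}$. Both are Banach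 spaces. Left translation operators: for $t\ge 0$, $T_t:X\to X$ is $(T_tf)(x)=f(x+t)$ for all $x\ge 0$. Each $T_t$ is a continuous linear operator on $X$. The quantity $\|(T_tf)\chi_{[0,a]}\|$ is computed by the same formula as the norm of $X$: it equals $\left(\int_0^a|f(x+t)|^pv(x)\,dx\right)^{1/p}$ when $X=L^p_v(\mathbb{R}_+)$, and $\sup\{|f(x+t)|v(x):x\in[0,a]\}$ when $X=C_{0,v}(\mathbb{R}_+)$ (even though $(T_tf)\chi_{[0,a]}$ need not be continuous). Hypercyclic: there is $f\in X$ whose orbit $\{T_tf:t\ge 0\}$ is a dense subset of $X$. *)

theory Defs
  imports "HOL-Analysis.Analysis"
begin

(* Functions on [0,\<infinity>) are represented as functions on the reals. The values of a weight at
   negative arguments are never used; the elements of the function spaces below are required to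
   be "extensional {0..}", so that equality of two of them is equality on [0,\<infinity>). *)

definition admissible_weight :: "(real \<Rightarrow> real) \<Rightarrow> bool" where
  "admissible_weight v \<longleftrightarrow>
     (\<forall>x\<ge>0. 0 < v x) \<and>
     (\<forall>b\<ge>0. v absolutely_integrable_on {0..b}) \<and>
     (\<exists>M\<ge>1. \<exists>w\<ge>0. \<forall>x\<ge>0. \<forall>t\<ge>0. v x \<le> M * exp (w * t) * v (x + t))"

definition left_translation :: "real \<Rightarrow> (real \<Rightarrow> real) \<Rightarrow> real \<Rightarrow> real" where
  "left_translation t f = (\<lambda>x\<in>{0..}. f (x + t))"

definition cutoff :: "real \<Rightarrow> (real \<Rightarrow> real) \<Rightarrow> real \<Rightarrow> real" where
  "cutoff a f = (\<lambda>x\<in>{0..}. f x * indicator {0..a} x)"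

definition hypercyclic :: "'a topology \<Rightarrow> (real \<Rightarrow> 'a \<Rightarrow> 'a) \<Rightarrow> bool" where
  "hypercyclic X T \<longleftrightarrow>
     (\<exists>f\<in>topspace X. X closure_of {T t f | t. 0 \<le> t} = topspace X)"


subsection \<open>The weighted Lebesgue spaces\<close>

definition Lp_fun :: "(real \<Rightarrow> real) \<Rightarrow> real \<Rightarrow> (real \<Rightarrow> real) set" where
  "Lp_fun v p = {f \<in> extensional {0..}. f \<in> borel_measurable (lebesgue_on {0..}) \<and>
                   integrable (lebesgue_on {0..}) (\<lambda>x. \<bar>f x\<bar> powr p * v x)}"

definition Lp_fun_norm :: "(real \<Rightarrow> real) \<Rightarrow> real \<Rightarrow> (real \<Rightarrow> real) \<Rightarrow> real" where
  "Lp_fun_norm v p f = (\<integral>x. \<bar>f x\<bar> powr p * v x \<partial>lebesgue_on {0..}) powr (1 / p)"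

definition Lp_eq :: "(real \<Rightarrow> real) \<Rightarrow> real \<Rightarrow> ((real \<Rightarrow> real) \<times> (real \<Rightarrow> real)) set" where
  "Lp_eq v p = {(f, g). f \<in> Lp_fun v p \<and> g \<in> Lp_fun v p \<and> (AE x in lebesgue_on {0..}. f x = g x)}"

definition Lp_space :: "(real \<Rightarrow> real) \<Rightarrow> real \<Rightarrow> (real \<Rightarrow> real) set set" where
  "Lp_space v p = Lp_fun v p // Lp_eq v p"

(* The operations on equivalence classes are induced by those on representatives; the lemmas
   below show that they do not depend on the choice of representatives. *)

definition Lp_norm :: "(real \<Rightarrow> real) \<Rightarrow> real \<Rightarrow> (real \<Rightarrow> real) set \<Rightarrow> real" where
  "Lp_norm v p F = the_elem (Lp_fun_norm v p ` F)"

definition Lp_minus ::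
  "(real \<Rightarrow> real) \<Rightarrow> real \<Rightarrow> (real \<Rightarrow> real) set \<Rightarrow> (real \<Rightarrow> real) set \<Rightarrow> (real \<Rightarrow> real) set" where
  "Lp_minus v p F G = (\<Union>f\<in>F. \<Union>g\<in>G. Lp_eq v p `` {\<lambda>x\<in>{0..}. f x - g x})"

definition Lp_translation ::
  "(real \<Rightarrow> real) \<Rightarrow> real \<Rightarrow> real \<Rightarrow> (real \<Rightarrow> real) set \<Rightarrow> (real \<Rightarrow> real) set" where
  "Lp_translation v p t F = (\<Union>f\<in>F. Lp_eq v p `` {left_translation t f})"

definition Lp_cutoff ::
  "(real \<Rightarrow> real) \<Rightarrow> real \<Rightarrow> real \<Rightarrow> (real \<Rightarrow> real) set \<Rightarrow> (real \<Rightarrow> real) set" where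
  "Lp_cutoff v p a F = (\<Union>f\<in>F. Lp_eq v p `` {cutoff a f})"

(* Metric_space asks for nonnegativity and symmetry of the distance also outside the carrier,
   hence the default value 0. *)
definition Lp_dist ::
  "(real \<Rightarrow> real) \<Rightarrow> real \<Rightarrow> (real \<Rightarrow> real) set \<Rightarrow> (real \<Rightarrow> real) set \<Rightarrow> real" where
  "Lp_dist v p F G =
     (if F \<in> Lp_space v p \<and> G \<in> Lp_space v p then Lp_norm v p (Lp_minus v p F G) else 0)"

definition Lp_topology :: "(real \<Rightarrow> real) \<Rightarrow> real \<Rightarrow> (real \<Rightarrow> real) set topology" where
  "Lp_topology v p = Metric_space.mtopology (Lp_space v p) (Lp_dist v p)"


subsection \<open>The weighted space of continuous functions\<close>

definition C0_space :: "(real \<Rightarrow> real) \<Rightarrow> (real \<Rightarrow> real) set" where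
  "C0_space v = {f \<in> extensional {0..}. continuous_on {0..} f \<and>
                   ((\<lambda>x. \<bar>f x\<bar> * v x) \<longlongrightarrow> 0) at_top}"

definition C0_norm :: "(real \<Rightarrow> real) \<Rightarrow> (real \<Rightarrow> real) \<Rightarrow> real" where
  "C0_norm v f = (SUP x\<in>{0..}. \<bar>f x\<bar> * v x)"

definition C0_dist :: "(real \<Rightarrow> real) \<Rightarrow> (real \<Rightarrow> real) \<Rightarrow> (real \<Rightarrow> real) \<Rightarrow> real" where
  "C0_dist v f g =
     (if f \<in> C0_space v \<and> g \<in> C0_space v then C0_norm v (\<lambda>x\<in>{0..}. f x - g x) else 0)"

definition C0_topology :: "(real \<Rightarrow> real) \<Rightarrow> (real \<Rightarrow> real) topology" where
  "C0_topology v = Metric_space.mtopology (C0_space v) (C0_dist v)"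


subsection \<open>Well-definedness\<close>

lemma halfline_lebesgue [simp]: "{0..} \<inter> space lebesgue \<in> sets (lebesgue :: real measure)"
  by simp

lemma admissible_weightE:
  assumes "admissible_weight v"
  obtains M w where "1 \<le> M" "0 \<le> w"
    "\<forall>x\<ge>0. \<forall>s\<ge>0. v x \<le> M * exp (w * s) * v (x + s)"
proof -
  have "\<exists>M\<ge>1. \<exists>w\<ge>0. \<forall>x\<ge>0. \<forall>s\<ge>0. v x \<le> M * exp (w * s) * v (x + s)"
    using assms unfolding admissible_weight_def by (elim conjE)
  then obtain M w where *: "1 \<le> M" "0 \<le> w" "\<forall>x\<ge>0. \<forall>s\<ge>0. v x \<le> M * exp (w * s) * v (x + s)"
    by (elim exE conjE)
  show thesis
    by (rule that[OF *])
qed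

lemma admissible_weight_measurable:
  assumes "admissible_weight v"
  shows "v \<in> borel_measurable (lebesgue_on {0..})"
proof -
  have "(\<lambda>x. indicator {0..} x *\<^sub>R v x) \<in> borel_measurable lebesgue"
  proof (rule borel_measurable_LIMSEQ_real)
    fix x :: real
    have "\<forall>\<^sub>F n in sequentially. indicator {0..real n} x *\<^sub>R v x = indicator {0..} x *\<^sub>R v x"
      using eventually_ge_at_top[of "nat \<lceil>x\<rceil>"]
      by eventually_elim (auto simp: indicator_def nat_ceiling_le_eq)
    then show "(\<lambda>n. indicator {0..real n} x *\<^sub>R v x) \<longlonglongrightarrow> indicator {0..} x *\<^sub>R v x"
      by (rule tendsto_eventually)
  next
    fix n :: nat
    have "v absolutely_integrable_on {0..real n}"
      using assms by (simp add: admissible_weight_def)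
    then show "(\<lambda>x. indicator {0..real n} x *\<^sub>R v x) \<in> borel_measurable lebesgue"
      unfolding set_integrable_def by (rule borel_measurable_integrable)
  qed
  then show ?thesis
    by (subst borel_measurable_restrict_space_iff) auto
qed

lemma powr_sum_le:
  fixes a b A B p :: real
  assumes "1 \<le> p" "0 \<le> a" "0 \<le> b" "0 < A" "0 < B"
  shows "(a + b) powr p \<le>
    (A + B) powr p * (A / (A + B) * (a / A) powr p + B / (A + B) * (b / B) powr p)"
proof -
  define s u where "s = A / (A + B)" and "u = B / (A + B)"
  have su: "0 < s" "0 < u" "s + u = 1"
    using assms by (auto simp: s_def u_def add_divide_distrib[symmetric])
  have small: "r powr p \<le> r" if "0 < r" "r \<le> 1" for r :: real
    using powr_mono'[of 1 p r] that assms by simp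
  have key: "(s * x + u * y) powr p \<le> s * x powr p + u * y powr p" if "0 \<le> x" "0 \<le> y" for x y
  proof (cases "x = 0 \<or> y = 0")
    case True
    then show ?thesis
      using small[of s] small[of u] su that assms
      by (auto simp: powr_mult intro!: mult_right_mono)
  next
    case False
    have s: "s = 1 - u" using su by simp
    show ?thesis
      unfolding s using convex_onD[OF powr_convex[OF \<open>1 \<le> p\<close>], of u x y] su that False by simp
  qed
  have "a + b = (A + B) * (s * (a / A) + u * (b / B))"
    using assms by (simp add: s_def u_def add_divide_distrib[symmetric])
  then have "(a + b) powr p = (A + B) powr p * (s * (a / A) + u * (b / B)) powr p"
    using assms su by (simp add: powr_mult)
  also have "\<dots> \<le> (A + B) powr p * (s * (a / A) powr p + u * (b / B) powr p)"
    using assms by (intro mult_left_mono key) auto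
  finally show ?thesis by (simp add: s_def u_def)
qed

lemma Lp_fun_diff:
  assumes v: "admissible_weight v" and p: "1 \<le> p" and f: "f \<in> Lp_fun v p" and g: "g \<in> Lp_fun v p"
  shows "(\<lambda>x\<in>{0..}. f x - g x) \<in> Lp_fun v p"
    and "Lp_fun_norm v p (\<lambda>x\<in>{0..}. f x - g x) \<le> Lp_fun_norm v p f + Lp_fun_norm v p g"
proof -
  let ?R = "lebesgue_on {0::real..}" and ?h = "\<lambda>x\<in>{0..}. f x - g x"
  have vpos: "0 < v x" if "0 \<le> x" for x
    using v that by (simp add: admissible_weight_def)
  have [measurable]: "f \<in> borel_measurable ?R" "g \<in> borel_measurable ?R" "v \<in> borel_measurable ?R"
    using f g admissible_weight_measurable[OF v] by (auto simp: Lp_fun_def)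
  have "?h \<in> borel_measurable ?R \<longleftrightarrow> (\<lambda>x. f x - g x) \<in> borel_measurable ?R"
    by (rule measurable_cong) simp
  then have [measurable]: "?h \<in> borel_measurable ?R" by simp
  have intf: "integrable ?R (\<lambda>x. \<bar>f x\<bar> powr p * v x)"
    and intg: "integrable ?R (\<lambda>x. \<bar>g x\<bar> powr p * v x)"
    using f g by (auto simp: Lp_fun_def)
  define U where "U A B x = (A + B) powr p *
    (A / (A + B) / A powr p * (\<bar>f x\<bar> powr p * v x) + B / (A + B) / B powr p * (\<bar>g x\<bar> powr p * v x))"
    for A B x
  have intU: "integrable ?R (U A B)" for A B
    unfolding U_def using intf intg by (intro integrable_mult_right Bochner_Integration.integrable_add)
  have le: "\<bar>?h x\<bar> powr p * v x \<le> U A B x" if "0 \<le> x" "0 < A" "0 < B" for A B x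
  proof -
    have "\<bar>?h x\<bar> powr p \<le> (\<bar>f x\<bar> + \<bar>g x\<bar>) powr p"
      using that p by (intro powr_mono2) auto
    also have "\<dots> \<le> (A + B) powr p *
        (A / (A + B) * (\<bar>f x\<bar> / A) powr p + B / (A + B) * (\<bar>g x\<bar> / B) powr p)"
      using that p by (intro powr_sum_le) auto
    finally have "\<bar>?h x\<bar> powr p * v x \<le> (A + B) powr p *
        (A / (A + B) * (\<bar>f x\<bar> / A) powr p + B / (A + B) * (\<bar>g x\<bar> / B) powr p) * v x"
      using vpos[OF that(1)] by (intro mult_right_mono) auto
    also have "\<dots> = U A B x"
      using that by (simp add: U_def powr_divide algebra_simps)
    finally show ?thesis .
  qed
  have inth: "integrable ?R (\<lambda>x. \<bar>?h x\<bar> powr p * v x)"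
  proof (rule Bochner_Integration.integrable_bound[OF intU[of 1 1]])
    show "AE x in ?R. norm (\<bar>?h x\<bar> powr p * v x) \<le> norm (U 1 1 x)"
    proof (rule AE_I2)
      fix x assume "x \<in> space ?R"
      then have x: "0 \<le> x" by simp
      have "norm (\<bar>?h x\<bar> powr p * v x) = \<bar>?h x\<bar> powr p * v x"
        using vpos[OF x] by (simp add: abs_mult)
      then show "norm (\<bar>?h x\<bar> powr p * v x) \<le> norm (U 1 1 x)"
        using le[OF x, of 1 1] by simp
    qed
  qed measurable
  then show "?h \<in> Lp_fun v p"
    by (simp add: Lp_fun_def)
  let ?I = "\<lambda>k. \<integral>x. \<bar>k x\<bar> powr p * v x \<partial>?R"
  have I0: "0 \<le> ?I k" for k
    using vpos by (intro integral_nonneg_AE AE_I2 mult_nonneg_nonneg) (auto intro: less_imp_le)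
  have bound: "?I k \<le> A powr p" if "Lp_fun_norm v p k < A" for k A
  proof -
    have "?I k = (?I k powr (1 / p)) powr p"
      using I0[of k] p by (simp add: powr_powr)
    also have "\<dots> \<le> A powr p"
      using that p unfolding Lp_fun_norm_def by (intro powr_mono2) auto
    finally show ?thesis .
  qed
  have main: "Lp_fun_norm v p ?h \<le> A + B"
    if A: "Lp_fun_norm v p f < A" and B: "Lp_fun_norm v p g < B" for A B
  proof -
    have pos: "0 < A" "0 < B"
      using A B by (auto simp: Lp_fun_norm_def intro: le_less_trans[OF powr_ge_zero])
    have "?I ?h \<le> integral\<^sup>L ?R (U A B)"
      using le pos by (intro integral_mono inth intU) auto
    also have "\<dots> = (A + B) powr p *
        (A / (A + B) / A powr p * ?I f + B / (A + B) / B powr p * ?I g)"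
      unfolding U_def using intf intg by simp
    also have "\<dots> \<le> (A + B) powr p *
        (A / (A + B) / A powr p * A powr p + B / (A + B) / B powr p * B powr p)"
      using bound[OF A] bound[OF B] pos by (intro mult_left_mono add_mono) auto
    also have "\<dots> = (A + B) powr p"
      using pos by (simp add: add_divide_distrib[symmetric])
    finally have "Lp_fun_norm v p ?h \<le> ((A + B) powr p) powr (1 / p)"
      unfolding Lp_fun_norm_def using p I0[of ?h] by (intro powr_mono2) auto
    then show ?thesis using p pos by (simp add: powr_powr)
  qed
  show "Lp_fun_norm v p ?h \<le> Lp_fun_norm v p f + Lp_fun_norm v p g"
  proof (rule field_le_epsilon)
    fix e :: real assume "0 < e"
    then show "Lp_fun_norm v p ?h \<le> Lp_fun_norm v p f + Lp_fun_norm v p g + e"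
      using main[of "Lp_fun_norm v p f + e / 2" "Lp_fun_norm v p g + e / 2"] by simp
  qed
qed

lemma Lp_fun_norm_cong:
  assumes "(f, g) \<in> Lp_eq v p" "admissible_weight v"
  shows "Lp_fun_norm v p f = Lp_fun_norm v p g"
proof -
  have [measurable]: "f \<in> borel_measurable (lebesgue_on {0..})"
    "g \<in> borel_measurable (lebesgue_on {0..})" "v \<in> borel_measurable (lebesgue_on {0..})"
    using assms admissible_weight_measurable by (auto simp: Lp_eq_def Lp_fun_def)
  have "AE x in lebesgue_on {0..}. f x = g x"
    using assms by (auto simp: Lp_eq_def)
  then have "(\<integral>x. \<bar>f x\<bar> powr p * v x \<partial>lebesgue_on {0..}) = (\<integral>x. \<bar>g x\<bar> powr p * v x \<partial>lebesgue_on {0..})"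
    by (intro integral_cong_AE) auto
  then show ?thesis by (simp add: Lp_fun_norm_def)
qed

lemma equiv_Lp_eq: "equiv (Lp_fun v p) (Lp_eq v p)"
proof (rule equivI)
  show "trans (Lp_eq v p)"
  proof (rule transI)
    fix f g h assume "(f, g) \<in> Lp_eq v p" "(g, h) \<in> Lp_eq v p"
    then have fh: "f \<in> Lp_fun v p" "h \<in> Lp_fun v p"
      and ae: "AE x in lebesgue_on {0..}. f x = g x" "AE x in lebesgue_on {0..}. g x = h x"
      by (auto simp: Lp_eq_def)
    from ae have "AE x in lebesgue_on {0..}. f x = h x" by eventually_elim simp
    with fh show "(f, h) \<in> Lp_eq v p" by (simp add: Lp_eq_def)
  qed
qed (auto simp: Lp_eq_def refl_on_def sym_def eq_commute)

lemma Lp_class_induced: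
  assumes "f \<in> Lp_fun v p" "\<And>g. (f, g) \<in> Lp_eq v p \<Longrightarrow> (h f, h g) \<in> Lp_eq v p"
  shows "(\<Union>g \<in> Lp_eq v p `` {f}. Lp_eq v p `` {h g}) = Lp_eq v p `` {h f}"
proof -
  have "Lp_eq v p `` {h g} = Lp_eq v p `` {h f}" if "(f, g) \<in> Lp_eq v p" for g
    using equiv_class_eq[OF equiv_Lp_eq assms(2)[OF that]] by simp
  moreover have "f \<in> Lp_eq v p `` {f}"
    using equiv_class_self[OF equiv_Lp_eq assms(1)] .
  ultimately show ?thesis by blast
qed

lemma Lp_norm_class:
  assumes "admissible_weight v" "f \<in> Lp_fun v p"
  shows "Lp_norm v p (Lp_eq v p `` {f}) = Lp_fun_norm v p f"
proof -
  have "Lp_fun_norm v p g = Lp_fun_norm v p f" if "g \<in> Lp_eq v p `` {f}" for g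
    using that Lp_fun_norm_cong[OF _ assms(1), of f g p] by simp
  moreover have "f \<in> Lp_eq v p `` {f}"
    using equiv_class_self[OF equiv_Lp_eq assms(2)] .
  ultimately have "Lp_fun_norm v p ` (Lp_eq v p `` {f}) = {Lp_fun_norm v p f}"
    by blast
  then show ?thesis by (simp add: Lp_norm_def)
qed

lemma Lp_minus_class:
  assumes "admissible_weight v" "1 \<le> p" "f \<in> Lp_fun v p" "g \<in> Lp_fun v p"
  shows "Lp_minus v p (Lp_eq v p `` {f}) (Lp_eq v p `` {g}) = Lp_eq v p `` {\<lambda>x\<in>{0..}. f x - g x}"
proof -
  have "((\<lambda>x\<in>{0..}. f x - g x), (\<lambda>x\<in>{0..}. f' x - g' x)) \<in> Lp_eq v p"
    if "(f, f') \<in> Lp_eq v p" "(g, g') \<in> Lp_eq v p" for f' g'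
  proof -
    from that have mem: "f' \<in> Lp_fun v p" "g' \<in> Lp_fun v p"
      and ae: "AE x in lebesgue_on {0..}. f x = f' x" "AE x in lebesgue_on {0..}. g x = g' x"
      by (auto simp: Lp_eq_def)
    from ae have "AE x in lebesgue_on {0..}. (\<lambda>x\<in>{0..}. f x - g x) x = (\<lambda>x\<in>{0..}. f' x - g' x) x"
      by eventually_elim (simp add: restrict_def)
    with mem assms show ?thesis
      by (auto simp: Lp_eq_def intro!: Lp_fun_diff)
  qed
  then have "Lp_eq v p `` {\<lambda>x\<in>{0..}. f' x - g' x} = Lp_eq v p `` {\<lambda>x\<in>{0..}. f x - g x}"
    if "f' \<in> Lp_eq v p `` {f}" "g' \<in> Lp_eq v p `` {g}" for f' g'
    using that equiv_class_eq[OF equiv_Lp_eq] by (metis Image_singleton_iff)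
  moreover have "f \<in> Lp_eq v p `` {f}" "g \<in> Lp_eq v p `` {g}"
    using equiv_class_self[OF equiv_Lp_eq] assms by auto
  ultimately show ?thesis unfolding Lp_minus_def by blast
qed

lemma Lp_dist_class:
  assumes "admissible_weight v" "1 \<le> p" "f \<in> Lp_fun v p" "g \<in> Lp_fun v p"
  shows "Lp_dist v p (Lp_eq v p `` {f}) (Lp_eq v p `` {g}) = Lp_fun_norm v p (\<lambda>x\<in>{0..}. f x - g x)"
  using assms by (simp add: Lp_dist_def Lp_space_def quotientI Lp_minus_class Lp_norm_class Lp_fun_diff)

lemma Lp_fun_norm_eq_0_iff:
  assumes v: "admissible_weight v" and p: "1 \<le> p" and f: "f \<in> Lp_fun v p"
  shows "Lp_fun_norm v p f = 0 \<longleftrightarrow> (AE x in lebesgue_on {0..}. f x = 0)"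
proof -
  have vpos: "0 < v x" if "0 \<le> x" for x
    using v that by (simp add: admissible_weight_def)
  have "Lp_fun_norm v p f = 0 \<longleftrightarrow> (\<integral>x. \<bar>f x\<bar> powr p * v x \<partial>lebesgue_on {0..}) = 0"
    by (simp add: Lp_fun_norm_def)
  also have "\<dots> \<longleftrightarrow> (AE x in lebesgue_on {0..}. \<bar>f x\<bar> powr p * v x = 0)"
  proof (rule integral_nonneg_eq_0_iff_AE)
    show "integrable (lebesgue_on {0..}) (\<lambda>x. \<bar>f x\<bar> powr p * v x)"
      using f by (simp add: Lp_fun_def)
    show "AE x in lebesgue_on {0..}. 0 \<le> \<bar>f x\<bar> powr p * v x"
    proof (rule AE_I2)
      fix x assume "x \<in> space (lebesgue_on {0::real..})"
      then have "0 < v x" using vpos[of x] by simp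
      then show "0 \<le> \<bar>f x\<bar> powr p * v x" by simp
    qed
  qed
  also have "\<dots> \<longleftrightarrow> (AE x in lebesgue_on {0..}. f x = 0)"
  proof (rule AE_cong)
    fix x assume "x \<in> space (lebesgue_on {0::real..})"
    then have "v x \<noteq> 0" using vpos[of x] by simp
    then show "\<bar>f x\<bar> powr p * v x = 0 \<longleftrightarrow> f x = 0" by simp
  qed
  finally show ?thesis .
qed

lemma Metric_space_Lp:
  assumes v: "admissible_weight v" and p: "1 \<le> p"
  shows "Metric_space (Lp_space v p) (Lp_dist v p)"
proof
  have rep: "\<exists>f\<in>Lp_fun v p. F = Lp_eq v p `` {f}" if "F \<in> Lp_space v p" for F
    using that by (auto simp: Lp_space_def elim!: quotientE)
  have comm: "Lp_fun_norm v p (\<lambda>x\<in>{0..}. f x - g x) = Lp_fun_norm v p (\<lambda>x\<in>{0..}. g x - f x)" for f g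
    unfolding Lp_fun_norm_def
    by (intro arg_cong[where f="\<lambda>y. y powr (1 / p)"] Bochner_Integration.integral_cong)
       (simp_all add: abs_minus_commute)
  show "0 \<le> Lp_dist v p F G" for F G
  proof (cases "F \<in> Lp_space v p \<and> G \<in> Lp_space v p")
    case True
    then obtain f g where "f \<in> Lp_fun v p" "F = Lp_eq v p `` {f}" "g \<in> Lp_fun v p" "G = Lp_eq v p `` {g}"
      using rep by meson
    then show ?thesis
      by (simp add: Lp_dist_class[OF v p] Lp_fun_norm_def)
  qed (auto simp: Lp_dist_def)
  show "Lp_dist v p F G = Lp_dist v p G F" for F G
  proof (cases "F \<in> Lp_space v p \<and> G \<in> Lp_space v p")
    case True
    then obtain f g where "f \<in> Lp_fun v p" "F = Lp_eq v p `` {f}" "g \<in> Lp_fun v p" "G = Lp_eq v p `` {g}"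
      using rep by meson
    then show ?thesis
      using comm by (simp add: Lp_dist_class[OF v p])
  qed (auto simp: Lp_dist_def)
  show "Lp_dist v p F G = 0 \<longleftrightarrow> F = G" if FG: "F \<in> Lp_space v p" "G \<in> Lp_space v p" for F G
  proof -
    obtain f g where fg: "f \<in> Lp_fun v p" "F = Lp_eq v p `` {f}" "g \<in> Lp_fun v p" "G = Lp_eq v p `` {g}"
      using rep[OF FG(1)] rep[OF FG(2)] by blast
    have "Lp_dist v p F G = 0 \<longleftrightarrow> (AE x in lebesgue_on {0..}. (\<lambda>x\<in>{0..}. f x - g x) x = 0)"
      using fg by (simp only: Lp_dist_class[OF v p] Lp_fun_norm_eq_0_iff[OF v p] Lp_fun_diff[OF v p])
    also have "\<dots> \<longleftrightarrow> (AE x in lebesgue_on {0..}. f x = g x)"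
      by (rule AE_cong) simp
    also have "\<dots> \<longleftrightarrow> F = G"
      using fg eq_equiv_class_iff[OF equiv_Lp_eq, of f v p g] by (simp add: Lp_eq_def)
    finally show ?thesis .
  qed
  show "Lp_dist v p F H \<le> Lp_dist v p F G + Lp_dist v p G H"
    if FGH: "F \<in> Lp_space v p" "G \<in> Lp_space v p" "H \<in> Lp_space v p" for F G H
  proof -
    obtain f g h where fgh: "f \<in> Lp_fun v p" "F = Lp_eq v p `` {f}"
        "g \<in> Lp_fun v p" "G = Lp_eq v p `` {g}" "h \<in> Lp_fun v p" "H = Lp_eq v p `` {h}"
      using rep[OF FGH(1)] rep[OF FGH(2)] rep[OF FGH(3)] by blast
    have "(\<lambda>x\<in>{0..}. f x - h x) =
        (\<lambda>x\<in>{0..}. (\<lambda>x\<in>{0..}. f x - g x) x - (\<lambda>x\<in>{0..}. h x - g x) x)"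
      by (auto simp: restrict_def)
    then have "Lp_fun_norm v p (\<lambda>x\<in>{0..}. f x - h x)
        \<le> Lp_fun_norm v p (\<lambda>x\<in>{0..}. f x - g x) + Lp_fun_norm v p (\<lambda>x\<in>{0..}. h x - g x)"
      using Lp_fun_diff(2)[OF v p Lp_fun_diff(1)[OF v p fgh(1,3)] Lp_fun_diff(1)[OF v p fgh(5,3)]]
      by simp
    then show ?thesis
      using fgh comm[of h g] by (simp add: Lp_dist_class[OF v p])
  qed
qed

lemma distr_lebesgue_translation: "distr lebesgue lebesgue (\<lambda>x. x + t) = (lebesgue :: real measure)"
proof -
  have shift: "(\<lambda>x. t + 1 * x) = (\<lambda>x. x + t)"
    by (auto simp: algebra_simps)
  show ?thesis
    using lebesgue_real_affine[of 1 t, symmetric] unfolding shift abs_one ennreal_1 density_1 by simp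
qed

lemma measurable_lebesgue_translation: "(\<lambda>x::real. x + t) \<in> lebesgue \<rightarrow>\<^sub>M lebesgue"
  using lebesgue_affine_measurable[of "\<lambda>_. 1" t] by (simp add: add.commute)

lemma left_translation_Lp_fun:
  assumes v: "admissible_weight v" and t: "0 \<le> t" and f: "f \<in> Lp_fun v p"
  shows "left_translation t f \<in> Lp_fun v p"
proof -
  obtain M w where "1 \<le> M" "0 \<le> w" and *: "\<forall>x\<ge>0. \<forall>s\<ge>0. v x \<le> M * exp (w * s) * v (x + s)"
    using v by (rule admissible_weightE)
  have Mw: "v x \<le> M * exp (w * s) * v (x + s)" if "0 \<le> x" "0 \<le> s" for x s
    using * that by simp
  have vpos: "0 < v x" if "0 \<le> x" for x
    using v that by (simp add: admissible_weight_def)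
  have shift_meas: "(\<lambda>x. g (x + t)) \<in> borel_measurable (lebesgue_on {0..})"
    if "g \<in> borel_measurable (lebesgue_on {0..})" for g :: "real \<Rightarrow> real"
  proof -
    have "(\<lambda>x. indicator {0..} x *\<^sub>R g x) \<in> borel_measurable lebesgue"
      using that by (subst (asm) borel_measurable_restrict_space_iff) auto
    from measurable_compose[OF measurable_lebesgue_translation[of t] this]
    have "(\<lambda>x. indicator {0..} (x + t) *\<^sub>R g (x + t)) \<in> borel_measurable (lebesgue_on {0..})"
      by (rule measurable_restrict_space1)
    also have "?this \<longleftrightarrow> ?thesis"
      using t by (intro measurable_cong) simp
    finally show ?thesis .
  qed
  have fm: "f \<in> borel_measurable (lebesgue_on {0..})"
    and fi: "integrable (lebesgue_on {0..}) (\<lambda>x. \<bar>f x\<bar> powr p * v x)"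
    using f by (auto simp: Lp_fun_def)
  have [measurable]: "v \<in> borel_measurable (lebesgue_on {0..})"
    by (rule admissible_weight_measurable[OF v])
  have "left_translation t f \<in> borel_measurable (lebesgue_on {0..}) \<longleftrightarrow>
      (\<lambda>x. f (x + t)) \<in> borel_measurable (lebesgue_on {0..})"
    by (rule measurable_cong) (simp add: left_translation_def)
  with shift_meas[OF fm] have [measurable]: "left_translation t f \<in> borel_measurable (lebesgue_on {0..})"
    by simp
  define k where "k x = indicator {0..} x *\<^sub>R (\<bar>f x\<bar> powr p * v x)" for x
  have "integrable lebesgue k"
    using fi unfolding k_def by (subst (asm) integrable_restrict_space) auto
  then have "integrable (distr lebesgue lebesgue (\<lambda>x. x + t)) k"
    by (simp only: distr_lebesgue_translation)
  then have "integrable lebesgue (\<lambda>x. k (x + t))"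
    by (rule integrable_distr[OF measurable_lebesgue_translation])
  then have "integrable (lebesgue_on {0..}) (\<lambda>x. k (x + t))"
    using integrable_mult_indicator[of "{0..}" lebesgue "\<lambda>x. k (x + t)"]
    by (subst integrable_restrict_space) auto
  then have "integrable (lebesgue_on {0..}) (\<lambda>x. M * exp (w * t) * k (x + t))"
    by (rule integrable_mult_right)
  then have "integrable (lebesgue_on {0..}) (\<lambda>x. \<bar>left_translation t f x\<bar> powr p * v x)"
  proof (rule Bochner_Integration.integrable_bound)
    show "AE x in lebesgue_on {0..}. norm (\<bar>left_translation t f x\<bar> powr p * v x)
        \<le> norm (M * exp (w * t) * k (x + t))"
    proof (rule AE_I2)
      fix x assume "x \<in> space (lebesgue_on {0::real..})"
      then have x: "0 \<le> x" by simp
      have "\<bar>f (x + t)\<bar> powr p * v x \<le> \<bar>f (x + t)\<bar> powr p * (M * exp (w * t) * v (x + t))"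
        using Mw[OF x t] by (intro mult_left_mono) auto
      also have "\<dots> = M * exp (w * t) * k (x + t)"
        using x t by (simp add: k_def)
      also have "\<dots> \<le> norm (M * exp (w * t) * k (x + t))"
        by simp
      finally show "norm (\<bar>left_translation t f x\<bar> powr p * v x) \<le> norm (M * exp (w * t) * k (x + t))"
        using x vpos[OF x] by (simp add: left_translation_def)
    qed
  qed measurable
  moreover have "left_translation t f \<in> extensional {0..}"
    by (simp add: left_translation_def)
  ultimately show ?thesis
    by (simp add: Lp_fun_def)
qed

lemma Lp_translation_class:
  assumes v: "admissible_weight v" and t: "0 \<le> t" and f: "f \<in> Lp_fun v p"
  shows "Lp_translation v p t (Lp_eq v p `` {f}) = Lp_eq v p `` {left_translation t f}"
  unfolding Lp_translation_def
proof (rule Lp_class_induced[OF f])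
  fix g assume g: "(f, g) \<in> Lp_eq v p"
  then have "AE x in lebesgue. 0 \<le> x \<longrightarrow> f x = g x"
    by (auto simp: Lp_eq_def AE_restrict_space_iff)
  then have "AE x in distr lebesgue lebesgue (\<lambda>x. x + t). 0 \<le> x \<longrightarrow> f x = g x"
    by (simp only: distr_lebesgue_translation)
  from AE_distrD[OF measurable_lebesgue_translation this]
  have "AE x in lebesgue. 0 \<le> x + t \<longrightarrow> f (x + t) = g (x + t)" .
  then have "AE x in lebesgue. x \<in> {0..} \<longrightarrow> left_translation t f x = left_translation t g x"
    by eventually_elim (use t in \<open>simp add: left_translation_def\<close>)
  then have "AE x in lebesgue_on {0..}. left_translation t f x = left_translation t g x"
    by (simp add: AE_restrict_space_iff)
  then show "(left_translation t f, left_translation t g) \<in> Lp_eq v p"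
    using g by (auto simp: Lp_eq_def intro: left_translation_Lp_fun[OF v t])
qed

lemma cutoff_Lp_fun:
  assumes v: "admissible_weight v" and p: "1 \<le> p" and f: "f \<in> Lp_fun v p"
  shows "cutoff a f \<in> Lp_fun v p"
proof -
  have [measurable]: "f \<in> borel_measurable (lebesgue_on {0..})" "v \<in> borel_measurable (lebesgue_on {0..})"
    and fi: "integrable (lebesgue_on {0..}) (\<lambda>x. \<bar>f x\<bar> powr p * v x)"
    using f admissible_weight_measurable[OF v] by (auto simp: Lp_fun_def)
  have "(\<lambda>x. indicator {0..a} x :: real) \<in> borel_measurable (lebesgue_on {0..})"
    by (intro measurable_restrict_space1 borel_measurable_indicator) simp
  then have "(\<lambda>x. f x * indicator {0..a} x) \<in> borel_measurable (lebesgue_on {0..})"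
    by measurable
  also have "?this \<longleftrightarrow> cutoff a f \<in> borel_measurable (lebesgue_on {0..})"
    by (rule measurable_cong) (simp add: cutoff_def)
  finally have [measurable]: "cutoff a f \<in> borel_measurable (lebesgue_on {0..})" .
  have "integrable (lebesgue_on {0..}) (\<lambda>x. \<bar>cutoff a f x\<bar> powr p * v x)"
  proof (rule Bochner_Integration.integrable_bound[OF fi])
    show "AE x in lebesgue_on {0..}. norm (\<bar>cutoff a f x\<bar> powr p * v x) \<le> norm (\<bar>f x\<bar> powr p * v x)"
      using p by (intro AE_I2) (auto simp: cutoff_def indicator_def)
  qed measurable
  then show ?thesis by (simp add: Lp_fun_def) (simp add: cutoff_def)
qed

lemma Lp_cutoff_class:
  assumes v: "admissible_weight v" and p: "1 \<le> p" and f: "f \<in> Lp_fun v p"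
  shows "Lp_cutoff v p a (Lp_eq v p `` {f}) = Lp_eq v p `` {cutoff a f}"
  unfolding Lp_cutoff_def
proof (rule Lp_class_induced[OF f])
  fix g assume g: "(f, g) \<in> Lp_eq v p"
  then have "AE x in lebesgue_on {0..}. f x = g x" by (auto simp: Lp_eq_def)
  then have "AE x in lebesgue_on {0..}. cutoff a f x = cutoff a g x"
    by eventually_elim (simp add: cutoff_def restrict_def)
  then show "(cutoff a f, cutoff a g) \<in> Lp_eq v p"
    using g by (auto simp: Lp_eq_def intro: cutoff_Lp_fun[OF v p])
qed

lemma Lp_norm_cutoff_translation:
  assumes v: "admissible_weight v" and p: "1 \<le> p" and t: "0 \<le> t" and f: "f \<in> Lp_fun v p"
  shows "Lp_norm v p (Lp_cutoff v p a (Lp_translation v p t (Lp_eq v p `` {f}))) =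
         (\<integral>x. \<bar>f (x + t)\<bar> powr p * v x \<partial>lebesgue_on {0..a}) powr (1 / p)"
proof -
  have "Lp_norm v p (Lp_cutoff v p a (Lp_translation v p t (Lp_eq v p `` {f}))) =
        Lp_fun_norm v p (cutoff a (left_translation t f))"
    using left_translation_Lp_fun[OF v t f]
    by (simp add: Lp_translation_class[OF v t f] Lp_cutoff_class[OF v p] Lp_norm_class[OF v]
        cutoff_Lp_fun[OF v p])
  moreover have "(\<integral>x. \<bar>cutoff a (left_translation t f) x\<bar> powr p * v x \<partial>lebesgue_on {0..}) =
      (\<integral>x. \<bar>f (x + t)\<bar> powr p * v x \<partial>lebesgue_on {0..a})"
    by (simp add: integral_restrict_space, rule Bochner_Integration.integral_cong)
       (use p in \<open>auto simp: cutoff_def left_translation_def indicator_def\<close>)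
  ultimately show ?thesis by (simp add: Lp_fun_norm_def)
qed

lemma admissible_weight_bounded:
  assumes "admissible_weight v"
  shows "\<exists>K. \<forall>x\<in>{0..b}. v x \<le> K"
proof -
  obtain M w where "1 \<le> M" "0 \<le> w" and *: "\<forall>x\<ge>0. \<forall>s\<ge>0. v x \<le> M * exp (w * s) * v (x + s)"
    using assms by (rule admissible_weightE)
  have Mw: "v x \<le> M * exp (w * s) * v (x + s)" if "0 \<le> x" "0 \<le> s" for x s
    using * that by simp
  have vpos: "0 < v x" if "0 \<le> x" for x
    using assms that by (simp add: admissible_weight_def)
  have "v x \<le> M * exp (w * b) * v b" if "x \<in> {0..b}" for x
  proof -
    have "v x \<le> M * exp (w * (b - x)) * v b"
      using Mw[of x "b - x"] that by simp
    also have "\<dots> \<le> M * exp (w * b) * v b"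
      using that \<open>1 \<le> M\<close> \<open>0 \<le> w\<close> vpos[of b]
      by (intro mult_right_mono mult_left_mono) (auto intro: mult_left_mono)
    finally show ?thesis .
  qed
  then show ?thesis by blast
qed

lemma C0_bdd_above:
  assumes v: "admissible_weight v" and f: "f \<in> C0_space v"
  shows "bdd_above ((\<lambda>x. \<bar>f x\<bar> * v x) ` {0..})"
proof -
  have vpos: "0 < v x" if "0 \<le> x" for x
    using v that by (simp add: admissible_weight_def)
  have cf: "continuous_on {0..} f" and lim: "((\<lambda>x. \<bar>f x\<bar> * v x) \<longlongrightarrow> 0) at_top"
    using f by (auto simp: C0_space_def)
  have "\<forall>\<^sub>F x in at_top. \<bar>f x\<bar> * v x < 1"
    using order_tendstoD(2)[OF lim, of 1] by simp
  then obtain b where b: "\<And>x. b \<le> x \<Longrightarrow> \<bar>f x\<bar> * v x < 1"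
    by (auto simp: eventually_at_top_linorder)
  obtain K where K: "\<And>x. x \<in> {0..b} \<Longrightarrow> v x \<le> K"
    using admissible_weight_bounded[OF v] by blast
  have "compact (f ` {0..b})"
    using continuous_on_subset[OF cf] by (intro compact_continuous_image) auto
  then obtain L where L: "\<And>x. x \<in> {0..b} \<Longrightarrow> \<bar>f x\<bar> \<le> L"
    using compact_imp_bounded by (fastforce simp: bounded_iff)
  show ?thesis
  proof (rule bdd_aboveI2)
    fix x :: real assume "x \<in> {0..}"
    then have x: "0 \<le> x" by simp
    show "\<bar>f x\<bar> * v x \<le> max 1 (L * K)"
    proof (cases "x \<le> b")
      case True
      then have "\<bar>f x\<bar> * v x \<le> L * K"
        using x L[of x] K[of x] vpos[of x] by (intro mult_mono) auto
      then show ?thesis by simp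
    next
      case False
      then show ?thesis using b[of x] by simp
    qed
  qed
qed

lemma C0_space_diff:
  assumes v: "admissible_weight v" and f: "f \<in> C0_space v" and g: "g \<in> C0_space v"
  shows "(\<lambda>x\<in>{0..}. f x - g x) \<in> C0_space v"
proof -
  have "continuous_on {0..} (\<lambda>x. f x - g x)"
    using f g by (auto simp: C0_space_def intro!: continuous_intros)
  moreover have "((\<lambda>x. \<bar>(\<lambda>x\<in>{0..}. f x - g x) x\<bar> * v x) \<longlongrightarrow> 0) at_top"
  proof (rule tendsto_sandwich[OF _ _ tendsto_const])
    show "((\<lambda>x. \<bar>f x\<bar> * v x + \<bar>g x\<bar> * v x) \<longlongrightarrow> 0) at_top"
      using f g by (auto simp: C0_space_def intro!: tendsto_add_zero)
    show "\<forall>\<^sub>F x in at_top. 0 \<le> \<bar>(\<lambda>x\<in>{0..}. f x - g x) x\<bar> * v x"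
      using eventually_ge_at_top[of 0]
    proof eventually_elim
      fix x :: real assume "0 \<le> x"
      then have "0 < v x" using v by (simp add: admissible_weight_def)
      then show "0 \<le> \<bar>(\<lambda>x\<in>{0..}. f x - g x) x\<bar> * v x" by simp
    qed
    show "\<forall>\<^sub>F x in at_top. \<bar>(\<lambda>x\<in>{0..}. f x - g x) x\<bar> * v x \<le> \<bar>f x\<bar> * v x + \<bar>g x\<bar> * v x"
      using eventually_ge_at_top[of 0]
    proof eventually_elim
      fix x :: real assume x: "0 \<le> x"
      then have "0 < v x" using v by (simp add: admissible_weight_def)
      then have "\<bar>f x - g x\<bar> * v x \<le> (\<bar>f x\<bar> + \<bar>g x\<bar>) * v x" by (intro mult_right_mono) auto
      with x show "\<bar>(\<lambda>x\<in>{0..}. f x - g x) x\<bar> * v x \<le> \<bar>f x\<bar> * v x + \<bar>g x\<bar> * v x"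
        by (simp add: algebra_simps)
    qed
  qed
  moreover have "continuous_on {0..} (\<lambda>x\<in>{0..}. f x - g x) \<longleftrightarrow> continuous_on {0..} (\<lambda>x. f x - g x)"
    by (rule continuous_on_cong) auto
  ultimately show ?thesis
    by (simp add: C0_space_def del: restrict_apply)
qed

lemma Metric_space_C0:
  assumes v: "admissible_weight v"
  shows "Metric_space (C0_space v) (C0_dist v)"
proof
  have vpos: "0 < v x" if "0 \<le> x" for x
    using v that by (simp add: admissible_weight_def)
  have upper: "\<bar>f x - g x\<bar> * v x \<le> C0_dist v f g"
    if "f \<in> C0_space v" "g \<in> C0_space v" "0 \<le> x" for f g x
    using cSUP_upper[OF _ C0_bdd_above[OF v C0_space_diff[OF v that(1,2)]], of x] that
    by (simp add: C0_dist_def C0_norm_def)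
  have least: "C0_dist v f g \<le> c"
    if "f \<in> C0_space v" "g \<in> C0_space v" "\<And>x. 0 \<le> x \<Longrightarrow> \<bar>f x - g x\<bar> * v x \<le> c" for f g c
    using that by (auto simp: C0_dist_def C0_norm_def intro!: cSUP_least)
  show nn: "0 \<le> C0_dist v f g" for f g
  proof (cases "f \<in> C0_space v \<and> g \<in> C0_space v")
    case True
    have "0 \<le> \<bar>f 0 - g 0\<bar> * v 0" using vpos[of 0] by simp
    with True upper[of f g 0] show ?thesis by simp
  qed (auto simp: C0_dist_def)
  show "C0_dist v f g = C0_dist v g f" for f g
    by (auto simp: C0_dist_def C0_norm_def abs_minus_commute intro!: SUP_cong)
  show "C0_dist v f g = 0 \<longleftrightarrow> f = g" if fg: "f \<in> C0_space v" "g \<in> C0_space v" for f g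
  proof
    assume 0: "C0_dist v f g = 0"
    show "f = g"
    proof (rule extensionalityI[of _ "{0..}"])
      fix x :: real assume "x \<in> {0..}"
      then have "\<bar>f x - g x\<bar> * v x \<le> 0" "0 < v x" using upper[OF fg, of x] 0 vpos by auto
      then show "f x = g x" by (simp add: mult_le_0_iff)
    qed (use fg in \<open>auto simp: C0_space_def\<close>)
  next
    assume "f = g"
    then show "C0_dist v f g = 0" using least[OF fg, of 0] nn[of f g] by simp
  qed
  show "C0_dist v f h \<le> C0_dist v f g + C0_dist v g h"
    if "f \<in> C0_space v" "g \<in> C0_space v" "h \<in> C0_space v" for f g h
  proof (rule least)
    fix x :: real assume x: "0 \<le> x"
    have "\<bar>f x - h x\<bar> * v x \<le> (\<bar>f x - g x\<bar> + \<bar>g x - h x\<bar>) * v x"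
      using vpos[OF x] by (intro mult_right_mono) auto
    then show "\<bar>f x - h x\<bar> * v x \<le> C0_dist v f g + C0_dist v g h"
      using upper[of f g x] upper[of g h x] that x by (simp add: algebra_simps)
  qed (use that in auto)
qed

lemma left_translation_C0_space:
  assumes v: "admissible_weight v" and t: "0 \<le> t" and f: "f \<in> C0_space v"
  shows "left_translation t f \<in> C0_space v"
proof -
  obtain M w where "1 \<le> M" "0 \<le> w" and *: "\<forall>x\<ge>0. \<forall>s\<ge>0. v x \<le> M * exp (w * s) * v (x + s)"
    using v by (rule admissible_weightE)
  have Mw: "v x \<le> M * exp (w * s) * v (x + s)" if "0 \<le> x" "0 \<le> s" for x s
    using * that by simp
  have vpos: "0 < v x" if "0 \<le> x" for x
    using v that by (simp add: admissible_weight_def)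
  have "continuous_on {0..} f" and lim: "((\<lambda>x. \<bar>f x\<bar> * v x) \<longlongrightarrow> 0) at_top"
    using f by (auto simp: C0_space_def)
  then have "continuous_on {0..} (\<lambda>x. f (x + t))"
    by (rule_tac continuous_on_compose2[of "{0..}" f]) (use t in \<open>auto intro!: continuous_intros\<close>)
  moreover have "((\<lambda>x. \<bar>left_translation t f x\<bar> * v x) \<longlongrightarrow> 0) at_top"
  proof (rule tendsto_sandwich[OF _ _ tendsto_const])
    have "filterlim (\<lambda>x. x + t) at_top at_top"
      using filterlim_tendsto_add_at_top[OF tendsto_const[of t] filterlim_ident] by (simp only: add.commute)
    from filterlim_compose[OF lim this]
    show "((\<lambda>x. M * exp (w * t) * (\<bar>f (x + t)\<bar> * v (x + t))) \<longlongrightarrow> 0) at_top"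
      by (rule tendsto_mult_right_zero)
    show "\<forall>\<^sub>F x in at_top. 0 \<le> \<bar>left_translation t f x\<bar> * v x"
      using eventually_ge_at_top[of 0]
    proof eventually_elim
      fix x :: real assume "0 \<le> x"
      then have "0 < v x" by (rule vpos)
      then show "0 \<le> \<bar>left_translation t f x\<bar> * v x" by simp
    qed
    show "\<forall>\<^sub>F x in at_top. \<bar>left_translation t f x\<bar> * v x \<le> M * exp (w * t) * (\<bar>f (x + t)\<bar> * v (x + t))"
      using eventually_ge_at_top[of 0]
    proof eventually_elim
      fix x :: real assume x: "0 \<le> x"
      have "\<bar>f (x + t)\<bar> * v x \<le> \<bar>f (x + t)\<bar> * (M * exp (w * t) * v (x + t))"
        using Mw[OF x t] by (intro mult_left_mono) auto
      with x show "\<bar>left_translation t f x\<bar> * v x \<le> M * exp (w * t) * (\<bar>f (x + t)\<bar> * v (x + t))"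
        by (simp add: left_translation_def algebra_simps)
    qed
  qed
  moreover have "continuous_on {0..} (left_translation t f) \<longleftrightarrow> continuous_on {0..} (\<lambda>x. f (x + t))"
    by (rule continuous_on_cong) (auto simp: left_translation_def)
  moreover have "left_translation t f \<in> extensional {0..}"
    by (simp add: left_translation_def)
  ultimately show ?thesis
    by (simp add: C0_space_def)
qed

lemma C0_norm_cutoff_translation:
  assumes v: "admissible_weight v" and t: "0 \<le> t" and a: "0 \<le> a" and f: "f \<in> C0_space v"
  shows "C0_norm v (cutoff a (left_translation t f)) = (SUP x\<in>{0..a}. \<bar>f (x + t)\<bar> * v x)"
proof -
  let ?g = "left_translation t f"
  have vpos: "0 < v x" if "0 \<le> x" for x
    using v that by (simp add: admissible_weight_def)
  have bdd: "bdd_above ((\<lambda>x. \<bar>?g x\<bar> * v x) ` {0..})"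
    by (rule C0_bdd_above[OF v left_translation_C0_space[OF v t f]])
  have eq: "\<bar>?g x\<bar> * v x = \<bar>f (x + t)\<bar> * v x" if "0 \<le> x" for x
    using that by (simp add: left_translation_def)
  have bdda: "bdd_above ((\<lambda>x. \<bar>f (x + t)\<bar> * v x) ` {0..a})"
    using bdd_above_mono[OF bdd, of "(\<lambda>x. \<bar>?g x\<bar> * v x) ` {0..a}"] eq by (simp add: image_mono)
  have nn: "0 \<le> (SUP x\<in>{0..a}. \<bar>f (x + t)\<bar> * v x)"
    using cSUP_upper[OF _ bdda, of 0] a vpos[of 0] by (auto intro: order_trans[rotated])
  have le: "\<bar>cutoff a ?g x\<bar> * v x \<le> (SUP x\<in>{0..a}. \<bar>f (x + t)\<bar> * v x)" if "0 \<le> x" for x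
  proof (cases "x \<le> a")
    case True
    then show ?thesis
      using that cSUP_upper[OF _ bdda, of x] by (simp add: cutoff_def left_translation_def)
  qed (use that nn in \<open>simp add: cutoff_def\<close>)
  show ?thesis
    unfolding C0_norm_def
  proof (rule antisym)
    show "(SUP x\<in>{0..}. \<bar>cutoff a ?g x\<bar> * v x) \<le> (SUP x\<in>{0..a}. \<bar>f (x + t)\<bar> * v x)"
      using le by (intro cSUP_least) auto
    show "(SUP x\<in>{0..a}. \<bar>f (x + t)\<bar> * v x) \<le> (SUP x\<in>{0..}. \<bar>cutoff a ?g x\<bar> * v x)"
    proof (rule cSUP_least)
      fix x assume x: "x \<in> {0..a}"
      have "bdd_above ((\<lambda>x. \<bar>cutoff a ?g x\<bar> * v x) ` {0..})"
        using le by (intro bdd_aboveI2) auto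
      from cSUP_upper[OF _ this, of x] x
      show "\<bar>f (x + t)\<bar> * v x \<le> (SUP x\<in>{0..}. \<bar>cutoff a ?g x\<bar> * v x)"
        by (simp add: cutoff_def left_translation_def)
    qed (use a in auto)
  qed
qed

end

theory Submission
  imports Defs
begin

text \<open>
  Both sides of the equivalence hold exactly when the weight \<open>v\<close> comes arbitrarily close to \<open>0\<close>
  arbitrarily far out, the condition called \<open>null_liminf\<close> below. The theorem is the cycle
  hypercyclic \<open>\<Longrightarrow>\<close> some window norm does not tend to \<open>0\<close> \<open>\<Longrightarrow>\<close> \<open>null_liminf v\<close> \<open>\<Longrightarrow>\<close> hypercyclic, run
  once in each of the two kinds of spaces. A window norm is \<open>\<parallel>(T\<^sub>t f) \<chi>\<parallel>\<close> with \<open>\<chi>\<close> the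
  characteristic function of \<open>[0, a]\<close>.

  First arrow (\<open>C0_hypercyclic_imp_not_tendsto\<close>, \<open>Lp_hypercyclic_imp_not_tendsto\<close>): the growth
  condition on \<open>v\<close> bounds the window norms of \<open>f\<close> for \<open>t\<close> in any bounded set. If they also
  tended to \<open>0\<close>, they would be bounded altogether, and then the orbit of \<open>f\<close> stays away from every
  function that is very large on \<open>[0, 1]\<close>.

  Second arrow (\<open>C0_cutoff_tendsto_0\<close>, \<open>Lp_cutoff_tendsto_0\<close>): if \<open>null_liminf v\<close> fails, then \<open>v\<close> is
  bounded below by a positive constant on the whole half line. As \<open>v\<close> is bounded above on
  \<open>[0, a]\<close>, the window norm at time \<open>t\<close> is at most a constant times the norm of the tail of \<open>f\<close>
  beyond \<open>t\<close>, and tails of elements of the spaces tend to \<open>0\<close>.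

  Third arrow (\<open>C0_hypercyclic_if_null_liminf\<close>, \<open>Lp_hypercyclic_if_null_liminf\<close>): a hypercyclic
  function is written down. Continuous compactly supported functions \<open>h\<^sub>1, h\<^sub>2, \<dots>\<close> that meet every
  nonempty open set of the space infinitely often are placed one after another at positions
  \<open>s\<^sub>1 < s\<^sub>2 < \<dots>\<close>.
  Translating the resulting function by \<open>s\<^sub>n\<close> puts \<open>h\<^sub>n\<close> at the origin, and what is left over are
  the later bumps. One point at which \<open>v\<close> is tiny makes \<open>v\<close> tiny on a long interval to its left,
  by the growth condition, so \<open>s\<^sub>m\<close> can be chosen such that the \<open>m\<close>-th bump costs at most
  \<open>2\<^sup>-\<^sup>m\<close> wherever a translation by an earlier \<open>s\<^sub>n\<close> moves it (\<open>bump_positions\<close>,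
  \<open>universal_function\<close>). The translate by \<open>s\<^sub>n\<close> therefore differs from \<open>h\<^sub>n\<close> by at most
  \<open>2\<^sup>-\<^sup>n\<close>, measured in the supremum norm or in the \<open>p\<close>-th power of the integral norm.
\<close>

section \<open>Hypercyclicity and the lower limit of the weight\<close>

lemma hypercyclic_mtopology_iff:
  assumes "Metric_space X d" and inv: "\<And>t f. 0 \<le> t \<Longrightarrow> f \<in> X \<Longrightarrow> T t f \<in> X"
  shows "hypercyclic (Metric_space.mtopology X d) T \<longleftrightarrow>
           (\<exists>f\<in>X. \<forall>g\<in>X. \<forall>e>0. \<exists>t\<ge>0. d g (T t f) < e)"
proof -
  interpret Metric_space X d by fact
  show ?thesis
    unfolding hypercyclic_def metric_closure_of topspace_mtopology
  proof (rule bex_cong[OF refl])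
    fix f assume f: "f \<in> X"
    have eq: "(\<exists>y\<in>{T t f |t. 0 \<le> t}. y \<in> mball g e) \<longleftrightarrow> (\<exists>t\<ge>0. d g (T t f) < e)"
      if "g \<in> X" for g e
      using inv[OF _ f] that by auto
    have "{x \<in> X. P x} = X \<longleftrightarrow> (\<forall>x\<in>X. P x)" for P :: "'a \<Rightarrow> bool"
      by blast
    then show "{x \<in> X. \<forall>r>0. \<exists>y\<in>{T t f |t. 0 \<le> t}. y \<in> mball x r} = X \<longleftrightarrow>
            (\<forall>g\<in>X. \<forall>e>0. \<exists>t\<ge>0. d g (T t f) < e)"
      by (simp only: eq cong: ball_cong)
  qed
qed

lemma admissible_weight_pos: "admissible_weight v \<Longrightarrow> 0 \<le> x \<Longrightarrow> 0 < v x"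
  by (simp add: admissible_weight_def)

definition null_liminf :: "(real \<Rightarrow> real) \<Rightarrow> bool" where
  "null_liminf v \<longleftrightarrow> (\<forall>e>0. \<forall>N. \<exists>x\<ge>N. v x < e)"

text \<open>
  Far out there is a lower bound by hypothesis; on the remaining bounded interval the growth
  condition compares \<open>v x\<close> with \<open>v 0\<close>.
\<close>

lemma bounded_below_if_not_null_liminf:
  assumes v: "admissible_weight v" and nl: "\<not> null_liminf v"
  shows "\<exists>c>0. \<forall>x\<ge>0. c \<le> v x"
proof -
  obtain e N where e: "0 < e" and N: "\<And>x. N \<le> x \<Longrightarrow> e \<le> v x"
    using nl by (auto simp: null_liminf_def not_less)
  obtain M w where M: "1 \<le> M" and w: "0 \<le> w"
    and Mw: "\<forall>x\<ge>0. \<forall>s\<ge>0. v x \<le> M * exp (w * s) * v (x + s)"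
    using v by (rule admissible_weightE)
  define c where "c = min e (v 0 / (M * exp (w * max 0 N)))"
  have "0 < c"
    using e M admissible_weight_pos[OF v, of 0] by (simp add: c_def)
  moreover have "c \<le> v x" if x: "0 \<le> x" for x
  proof (cases "N \<le> x")
    case True
    then show ?thesis using N[of x] by (simp add: c_def)
  next
    case False
    have "v 0 \<le> M * exp (w * x) * v (0 + x)"
      using Mw x by blast
    also have "\<dots> \<le> M * exp (w * max 0 N) * v x"
      using False x M w admissible_weight_pos[OF v x]
      by (intro mult_mono) (auto intro!: mult_left_mono)
    finally have "v 0 / (M * exp (w * max 0 N)) \<le> v x"
      using M by (simp add: field_simps)
    then show ?thesis by (simp add: c_def)
  qed
  ultimately show ?thesis by blast
qed

section \<open>Construction of a universal function\<close>

text \<open>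
  The interval on which \<open>v\<close> has to be small is the support \<open>[-1, b m]\<close> of the \<open>m\<close>-th bump, moved to
  \<open>s m\<close> and then back by some earlier \<open>s n\<close>. All these intervals lie within a bounded distance to the
  left of the point \<open>s m + b m\<close>, and the distance is known before \<open>s m\<close> is chosen. So it suffices to
  take as \<open>s m + b m\<close> a point at which \<open>v\<close> is small enough to absorb the growth factor.
\<close>

lemma bump_positions:
  fixes b c :: "nat \<Rightarrow> real"
  assumes v: "admissible_weight v" and nl: "null_liminf v"
    and b: "\<And>m. 0 \<le> b m" and c: "\<And>m. 0 < c m"
  obtains s where "s 0 = 0" "\<And>m. s m + b m + 2 \<le> s (Suc m)"
    "\<And>m n y. n < m \<Longrightarrow> s m - s n - 1 \<le> y \<Longrightarrow> y \<le> s m - s n + b m \<Longrightarrow> v y \<le> c m"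
proof -
  obtain M w where M: "1 \<le> M" and w: "0 \<le> w"
    and Mw: "\<forall>x\<ge>0. \<forall>s\<ge>0. v x \<le> M * exp (w * s) * v (x + s)"
    using v by (rule admissible_weightE)
  define Q where "Q m s s' \<longleftrightarrow> s + b m + 2 \<le> s' \<and> (\<forall>t y. 0 \<le> t \<longrightarrow> t \<le> s \<longrightarrow>
      s' - t - 1 \<le> y \<longrightarrow> y \<le> s' - t + b (Suc m) \<longrightarrow> v y \<le> c (Suc m))" for m s s'
  have step: "\<exists>s'. 0 \<le> s' \<and> Q m s s'" if s: "0 \<le> s" for m s
  proof -
    define L where "L = b (Suc m) + 1 + s"
    have "0 < c (Suc m) / (M * exp (w * L))" using c M by simp
    then obtain x where x: "s + b m + 2 + b (Suc m) \<le> x"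
      and vx: "v x < c (Suc m) / (M * exp (w * L))"
      using nl unfolding null_liminf_def by blast
    have x0: "0 \<le> x" using x s b[of m] b[of "Suc m"] by linarith
    have "v y \<le> c (Suc m)" if t: "0 \<le> t" "t \<le> s" and y: "x - b (Suc m) - t - 1 \<le> y" "y \<le> x - t" for t y
    proof -
      have y0: "0 \<le> y" "y \<le> x" "x - y \<le> L" using x t y s b[of m] by (auto simp: L_def)
      have "v y \<le> M * exp (w * (x - y)) * v (y + (x - y))"
        using Mw y0 by (metis diff_ge_0_iff_ge)
      also have "\<dots> \<le> M * exp (w * L) * v x"
        using y0 M w admissible_weight_pos[OF v x0]
        by (intro mult_mono) (auto intro!: mult_left_mono)
      also have "\<dots> \<le> c (Suc m)"
        using vx M by (simp add: field_simps)
      finally show ?thesis .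
    qed
    then have "Q m s (x - b (Suc m))" using x by (auto simp: Q_def)
    moreover have "0 \<le> x - b (Suc m)" using x s b[of m] by linarith
    ultimately show ?thesis by blast
  qed
  have "\<exists>s. \<forall>n. (0 \<le> s n \<and> (n = 0 \<longrightarrow> s n = 0)) \<and> Q n (s n) (s (Suc n))"
    by (rule dependent_nat_choice) (use step in auto)
  then obtain s where s: "\<And>n. 0 \<le> s n" "s 0 = 0" "\<And>n. Q n (s n) (s (Suc n))" by blast
  have "s n \<le> s (Suc n)" for n
    using s(3)[of n] b[of n] unfolding Q_def by linarith
  then have inc: "s n \<le> s m" if "n \<le> m" for n m
    using that by (rule lift_Suc_mono_le)
  show thesis
  proof (rule that)
    show "s 0 = 0" by fact
    show "s m + b m + 2 \<le> s (Suc m)" for m using s(3)[of m] by (simp add: Q_def)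
    show "v y \<le> c m" if "n < m" "s m - s n - 1 \<le> y" "y \<le> s m - s n + b m" for m n y
    proof (cases m)
      case (Suc k)
      then show ?thesis using s(3)[of k] that inc[of n k] s(1)[of n] by (auto simp: Q_def)
    qed (use that in simp)
  qed
qed

text \<open>
  The supports are disjoint, so after translation by \<open>s n\<close> a point \<open>y \<ge> 0\<close> sees, apart from the
  bump \<open>h n\<close>, at most one other bump, and that one has a larger index because earlier bumps have
  moved to the negative half line. Gaps of length at least \<open>1\<close> keep the sum locally finite, hence
  continuous. Supports start at \<open>-1\<close> to leave room for a continuous rise to the value at \<open>0\<close>.
\<close>

lemma bump_train:
  fixes h :: "nat \<Rightarrow> real \<Rightarrow> real" and b s :: "nat \<Rightarrow> real"
  assumes cont: "\<And>m. continuous_on UNIV (h m)"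
    and supp: "\<And>m y. h m y \<noteq> 0 \<Longrightarrow> - 1 \<le> y \<and> y \<le> b m"
    and b: "\<And>m. 0 \<le> b m"
    and s0: "s 0 = 0" and gap: "\<And>m. s m + b m + 2 \<le> s (Suc m)"
  obtains f where "continuous_on UNIV f"
    "\<And>n y. 0 \<le> y \<Longrightarrow> f (y + s n) = h n y \<or> 
        (\<exists>m>n. s m - s n - 1 \<le> y \<and> y \<le> s m - s n + b m \<and> f (y + s n) - h n y = h m (y + s n - s m))"
proof -
  define f where "f x = (\<Sum>m\<le>nat \<lceil>x\<rceil> + 1. h m (x - s m))" for x
  have sep: "s n + b n + 2 \<le> s m" if "n < m" for n m
  proof -
    have "s k \<le> s (Suc k)" for k
      using gap[of k] b[of k] by linarith
    then have "s (Suc n) \<le> s m"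
      by (rule lift_Suc_mono_le) (use that in simp)
    then show ?thesis using gap[of n] by linarith
  qed
  have large: "real m \<le> s m" for m
  proof (induction m)
    case (Suc m)
    then show ?case using gap[of m] b[of m] by simp
  qed (simp add: s0)
  have far: "h m (x - s m) = 0" if "x + 1 < real m" for m x
    using supp[of m "x - s m"] large[of m] that by linarith
  \<comment> \<open>As \<open>s m \<ge> m\<close>, the sum may be extended to any larger index; one common index then serves a
    whole neighbourhood of a point.\<close>
  have f_eq: "f x = (\<Sum>m\<le>N. h m (x - s m))" if "x + 1 \<le> real N" for x N
  proof -
    have "f x = (\<Sum>m\<le>max N (nat \<lceil>x\<rceil> + 1). h m (x - s m))"
      unfolding f_def
    proof (rule sum.mono_neutral_left)
      show "\<forall>i\<in>{..max N (nat \<lceil>x\<rceil> + 1)} - {..nat \<lceil>x\<rceil> + 1}. h i (x - s i) = 0"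
      proof
        fix i assume "i \<in> {..max N (nat \<lceil>x\<rceil> + 1)} - {..nat \<lceil>x\<rceil> + 1}"
        then have "nat \<lceil>x\<rceil> + 1 < i" by auto
        then have "x + 1 < real i" by linarith
        then show "h i (x - s i) = 0" by (rule far)
      qed
    qed auto
    also have "\<dots> = (\<Sum>m\<le>N. h m (x - s m))"
      by (rule sum.mono_neutral_right) (use that far in auto)
    finally show ?thesis .
  qed
  have "isCont f x" for x
  proof -
    define N where "N = nat \<lceil>x\<rceil> + 2"
    have xN: "x + 1 < real N" unfolding N_def by linarith
    have "continuous_on UNIV (\<lambda>x. \<Sum>m\<le>N. h m (x - s m))"
      by (rule continuous_on_sum, rule continuous_on_compose2[OF cont])
         (auto intro!: continuous_on_diff continuous_on_id continuous_on_const)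
    then have "isCont (\<lambda>x. \<Sum>m\<le>N. h m (x - s m)) x"
      by (simp add: continuous_on_eq_continuous_at)
    moreover have "\<forall>\<^sub>F z in nhds x. z + 1 \<le> real N"
      using eventually_nhds_in_open[of "{..<real N - 1}" x] xN
      by (auto elim!: eventually_mono)
    then have "\<forall>\<^sub>F z in nhds x. f z = (\<Sum>m\<le>N. h m (z - s m))"
      by eventually_elim (rule f_eq)
    ultimately show ?thesis by (simp add: isCont_cong)
  qed
  then have "continuous_on UNIV f" by (simp add: continuous_on_eq_continuous_at)
  moreover have "f (y + s n) = h n y \<or> 
        (\<exists>m>n. s m - s n - 1 \<le> y \<and> y \<le> s m - s n + b m \<and> f (y + s n) - h n y = h m (y + s n - s m))"
    if y: "0 \<le> y" for n y
  proof -
    define N where "N = max n (nat \<lceil>y + s n\<rceil> + 1)"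
    have "y + s n + 1 \<le> real N" unfolding N_def by linarith
    then have "f (y + s n) = (\<Sum>m\<le>N. h m (y + s n - s m))" by (rule f_eq)
    also have "\<dots> = h n y + (\<Sum>m\<in>{..N} - {n}. h m (y + s n - s m))"
      by (subst sum.remove[of _ n]) (auto simp: N_def)
    finally have eq: "f (y + s n) - h n y = (\<Sum>m\<in>{..N} - {n}. h m (y + s n - s m))" by simp
    show ?thesis
    proof (cases "\<exists>m\<in>{..N} - {n}. h m (y + s n - s m) \<noteq> 0")
      case False
      then have "(\<Sum>m\<in>{..N} - {n}. h m (y + s n - s m)) = 0" by (intro sum.neutral) auto
      then show ?thesis using eq by simp
    next
      case True
      then obtain m where m: "m \<le> N" "m \<noteq> n" and nz: "h m (y + s n - s m) \<noteq> 0" by auto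
      have rng: "s m - s n - 1 \<le> y" "y \<le> s m - s n + b m" using supp[OF nz] by auto
      have "n < m"
      proof (rule ccontr)
        assume "\<not> n < m"
        with m have "m < n" by simp
        from sep[OF this] rng y show False by linarith
      qed
      moreover have "h k (y + s n - s k) = 0" if "k \<noteq> m" for k
      proof (rule ccontr)
        assume "h k (y + s n - s k) \<noteq> 0"
        from supp[OF this] have "s k - s n - 1 \<le> y" "y \<le> s k - s n + b k" by auto
        with rng that sep[of k m] sep[of m k] show False by linarith
      qed
      then have "(\<Sum>k\<in>{..N} - {n}. h k (y + s n - s k)) = h m (y + s n - s m)"
        using m by (subst sum.remove[of _ m]) auto
      ultimately show ?thesis using eq rng by auto
    qed
  qed
  ultimately show thesis by (rule that) 
qed

text \<open>
  The two kinds of spaces need different smallness of the bumps: a bound on the supremum of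
  \<open>\<bar>u\<bar> v\<close>, or on the integral of \<open>\<bar>u\<bar>\<^sup>p v\<close>. The pointwise bound \<open>2\<^sup>-\<^sup>m / (b m + 1)\<close> gives both,
  since \<open>b m + 1\<close> is the length of the support of the \<open>m\<close>-th bump.
\<close>

lemma universal_function:
  fixes h :: "nat \<Rightarrow> real \<Rightarrow> real" and b :: "nat \<Rightarrow> real"
  assumes v: "admissible_weight v" and nl: "null_liminf v"
    and cont: "\<And>m. continuous_on UNIV (h m)"
    and supp: "\<And>m y. h m y \<noteq> 0 \<Longrightarrow> - 1 \<le> y \<and> y \<le> b m"
    and b: "\<And>m. 0 \<le> b m" and p: "0 \<le> p"
  obtains f s where "continuous_on UNIV f" "s 0 = 0" "\<And>m. s m + b m + 2 \<le> s (Suc m)"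
    "\<And>n y. 0 \<le> y \<Longrightarrow> f (y + s n) = h n y \<or> 
        (\<exists>m>n. s m - s n - 1 \<le> y \<and> y \<le> s m - s n + b m \<and>
           \<bar>f (y + s n) - h n y\<bar> powr p * v y \<le> (1 / 2) ^ m / (b m + 1))"
proof -
  have "\<exists>B>0. \<forall>y. \<bar>h m y\<bar> \<le> B" for m
  proof -
    have "compact (h m ` {- 1..b m})"
      using continuous_on_subset[OF cont] by (intro compact_continuous_image) auto
    then have "bounded (h m ` {- 1..b m})" by (rule compact_imp_bounded)
    then obtain B where "0 < B" "\<forall>z\<in>h m ` {- 1..b m}. norm z \<le> B"
      unfolding bounded_pos by blast
    then have B: "0 < B" "\<And>y. y \<in> {- 1..b m} \<Longrightarrow> \<bar>h m y\<bar> \<le> B" by auto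
    have "\<bar>h m y\<bar> \<le> B" for y
      using B supp[of m y] by (cases "h m y = 0") auto
    then show ?thesis using B by blast
  qed
  then obtain B where B: "\<And>m. 0 < B m" "\<And>m y. \<bar>h m y\<bar> \<le> B m" by metis
  define c where "c m = (1 / 2) ^ m / (b m + 1) / B m powr p" for m
  have c: "0 < c m" for m using B(1)[of m] b[of m] by (simp add: c_def add_nonneg_pos)
  obtain s where s: "s 0 = 0" "\<And>m. s m + b m + 2 \<le> s (Suc m)"
    "\<And>m n y. n < m \<Longrightarrow> s m - s n - 1 \<le> y \<Longrightarrow> y \<le> s m - s n + b m \<Longrightarrow> v y \<le> c m"
    by (rule bump_positions[OF v nl b c]) (rule that)
  obtain f where f: "continuous_on UNIV f"
    "\<And>n y. 0 \<le> y \<Longrightarrow> f (y + s n) = h n y \<or> 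
        (\<exists>m>n. s m - s n - 1 \<le> y \<and> y \<le> s m - s n + b m \<and> f (y + s n) - h n y = h m (y + s n - s m))"
  proof (rule bump_train[of h b s])
    show "continuous_on UNIV (h m)" for m by (rule cont)
    show "- 1 \<le> y \<and> y \<le> b m" if "h m y \<noteq> 0" for m y using that by (rule supp)
  qed (rule b s that; assumption)+
  have le: "\<bar>h m z\<bar> powr p * v y \<le> (1 / 2) ^ m / (b m + 1)" if "0 \<le> y" "v y \<le> c m" for m y z
  proof -
    have "\<bar>h m z\<bar> powr p * v y \<le> B m powr p * c m"
      using that B(1)[of m] B(2)[of m z] p admissible_weight_pos[OF v that(1)]
      by (intro mult_mono powr_mono2) auto
    then show ?thesis using B(1)[of m] by (simp add: c_def)
  qed
  show thesis
  proof (rule that[OF f(1) s(1,2)])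
    fix n y assume y: "0 \<le> (y::real)"
    show "f (y + s n) = h n y \<or> 
        (\<exists>m>n. s m - s n - 1 \<le> y \<and> y \<le> s m - s n + b m \<and>
           \<bar>f (y + s n) - h n y\<bar> powr p * v y \<le> (1 / 2) ^ m / (b m + 1))"
      using f(2)[OF y, of n] le[OF y] s(3)[of n _ y] by metis
  qed
qed

section \<open>A countable family of test functions\<close>

definition plateau :: "nat \<Rightarrow> real \<Rightarrow> real" where
  "plateau k x = max 0 (min 1 (min (x + 1) (real k + 1 - x)))"

lemma continuous_on_plateau: "continuous_on S (plateau k)"
  unfolding plateau_def by (intro continuous_intros)

lemma plateau_bounds: "0 \<le> plateau k x" "plateau k x \<le> 1"
  unfolding plateau_def by linarith+

lemma plateau_eq_1: "0 \<le> x \<Longrightarrow> x \<le> real k \<Longrightarrow> plateau k x = 1"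
  unfolding plateau_def by linarith

lemma plateau_support: "plateau k x \<noteq> 0 \<Longrightarrow> - 1 \<le> x \<and> x \<le> real k + 1"
  unfolding plateau_def by linarith

definition test_fun :: "rat list \<times> nat \<Rightarrow> real \<Rightarrow> real" where
  "test_fun = (\<lambda>(cs, k) x. plateau k x * (\<Sum>i<length cs. of_rat (cs ! i) * x ^ i))"

text \<open>
  Decoding a pair and forgetting one component makes every test function occur infinitely often in
  the sequence. The term of index \<open>0\<close> is zero so that the universal function is, up to the position
  \<open>s 0 = 0\<close>, its own error of index \<open>0\<close>; the error estimate then also shows that it belongs to the
  space.
\<close>

definition test_seq :: "nat \<Rightarrow> real \<Rightarrow> real" where
  "test_seq n = (if n = 0 then (\<lambda>_. 0) else test_fun (from_nat (fst (prod_decode n))))"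

definition test_end :: "nat \<Rightarrow> real" where
  "test_end n = real (snd (from_nat (fst (prod_decode n)) :: rat list \<times> nat)) + 1"

lemma continuous_on_test_seq: "continuous_on S (test_seq n)"
proof (cases "n = 0")
  case False
  obtain cs k where "from_nat (fst (prod_decode n)) = (cs :: rat list, k :: nat)"
    by fastforce
  then have eq: "test_seq n = (\<lambda>x. plateau k x * (\<Sum>i<length cs. of_rat (cs ! i) * x ^ i))"
    using False by (simp add: test_seq_def test_fun_def)
  show ?thesis
    unfolding eq by (intro continuous_on_mult continuous_on_plateau continuous_intros)
qed (simp add: test_seq_def)

lemma test_seq_support: "test_seq n y \<noteq> 0 \<Longrightarrow> - 1 \<le> y \<and> y \<le> test_end n"
proof (cases "n = 0")
  case False
  assume nz: "test_seq n y \<noteq> 0"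
  obtain cs k where eq: "from_nat (fst (prod_decode n)) = (cs :: rat list, k :: nat)"
    by fastforce
  then have "plateau k y \<noteq> 0"
    using nz False by (simp add: test_seq_def test_fun_def)
  then show ?thesis
    using plateau_support by (simp add: test_end_def eq)
qed (simp add: test_seq_def)

lemma test_end_nonneg: "0 \<le> test_end n"
  by (simp add: test_end_def)

text \<open>
  Weierstrass approximation, followed by a perturbation of the finitely many coefficients.
\<close>

lemma rational_polynomial_approx:
  fixes g :: "real \<Rightarrow> real"
  assumes g: "continuous_on {a..b} g" and e: "0 < e"
  shows "\<exists>cs :: rat list. \<forall>x\<in>{a..b}. \<bar>g x - (\<Sum>i<length cs. of_rat (cs ! i) * x ^ i)\<bar> < e"
proof -
  obtain q where q: "real_polynomial_function q" "\<And>x. x \<in> {a..b} \<Longrightarrow> \<bar>g x - q x\<bar> < e / 2"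
    using Stone_Weierstrass_real_polynomial_function[OF _ g, of "e / 2"] e by auto
  obtain u n where u: "q = (\<lambda>x. \<Sum>i\<le>n. u i * x ^ i)"
    using q(1) by (auto simp: real_polynomial_function_iff_sum)
  define L where "L = (max 1 (max \<bar>a\<bar> \<bar>b\<bar>)) ^ n"
  have L: "1 \<le> L" by (simp add: L_def)
  have pow: "\<bar>x ^ i\<bar> \<le> L" if "x \<in> {a..b}" "i \<le> n" for x i
  proof -
    have "\<bar>x\<bar> ^ i \<le> (max 1 (max \<bar>a\<bar> \<bar>b\<bar>)) ^ i"
      using that by (intro power_mono) auto
    also have "\<dots> \<le> L" unfolding L_def using that by (intro power_increasing) auto
    finally show ?thesis by (simp add: power_abs)
  qed
  \<comment> \<open>Each of the \<open>n + 1\<close> monomials is at most \<open>L\<close>, so this change of the coefficients costs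
    \<open>e / 2\<close> in total.\<close>
  define d where "d = e / (2 * (n + 1) * L)"
  have d: "0 < d" using e L by (simp add: d_def)
  have "\<exists>r. \<bar>u i - of_rat r\<bar> < d" for i
  proof -
    obtain r where "u i - d < of_rat r" "of_rat r < u i + d"
      using of_rat_dense[of "u i - d" "u i + d"] d by auto
    then show ?thesis by (intro exI[of _ r]) (auto simp: abs_if)
  qed
  then obtain r where r: "\<And>i. \<bar>u i - of_rat (r i)\<bar> < d" by metis
  have "\<bar>g x - (\<Sum>i<length (map r [0..<Suc n]). of_rat (map r [0..<Suc n] ! i) * x ^ i)\<bar> < e"
    if x: "x \<in> {a..b}" for x
  proof -
    have "(\<Sum>i<length (map r [0..<Suc n]). of_rat (map r [0..<Suc n] ! i) * x ^ i)
        = (\<Sum>i\<le>n. of_rat (r i) * x ^ i)"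
      by (rule sum.cong) (auto simp del: upt_Suc)
    moreover have "\<bar>q x - (\<Sum>i\<le>n. of_rat (r i) * x ^ i)\<bar> \<le> (\<Sum>i\<le>n. d * L)"
    proof -
      have "\<bar>q x - (\<Sum>i\<le>n. of_rat (r i) * x ^ i)\<bar> = \<bar>\<Sum>i\<le>n. (u i - of_rat (r i)) * x ^ i\<bar>"
        by (simp add: u sum_subtractf algebra_simps)
      also have "\<dots> \<le> (\<Sum>i\<le>n. \<bar>(u i - of_rat (r i)) * x ^ i\<bar>)" by (rule sum_abs)
      also have "\<dots> \<le> (\<Sum>i\<le>n. d * L)"
        using r pow[OF x] d by (intro sum_mono) (auto simp: abs_mult less_imp_le intro!: mult_mono)
      finally show ?thesis .
    qed
    moreover have "d * L = e / 2 / real (Suc n)" using L by (simp add: d_def)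
    then have "(\<Sum>i\<le>n. d * L) = e / 2" by (simp del: of_nat_Suc)
    ultimately show ?thesis using q(2)[OF x] by linarith
  qed
  then show ?thesis by blast
qed

text \<open>
  Multiplying the approximation by the plateau function on both sides makes the error vanish off the
  support, where a polynomial alone would be uncontrolled.
\<close>

lemma test_seq_dense:
  assumes g: "continuous_on UNIV g" and e: "0 < e"
  shows "\<exists>n\<ge>N. \<forall>x. \<bar>plateau k x * g x - test_seq n x\<bar> \<le> e * plateau k x"
proof -
  obtain cs :: "rat list" where
    cs: "\<And>x. x \<in> {- 1..real k + 1} \<Longrightarrow> \<bar>g x - (\<Sum>i<length cs. of_rat (cs ! i) * x ^ i)\<bar> < e"
    using rational_polynomial_approx[OF continuous_on_subset[OF g subset_UNIV] e, of "- 1" "real k + 1"] by blast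
  define n where "n = prod_encode (to_nat (cs, k), Suc N)"
  have "Suc N \<le> n" unfolding n_def by (rule le_prod_encode_2)
  then have n: "N \<le> n" "test_seq n = test_fun (cs, k)" by (auto simp: test_seq_def n_def)
  have "\<bar>plateau k x * g x - test_seq n x\<bar> \<le> e * plateau k x" for x
  proof -
    have "plateau k x * g x - test_seq n x
        = plateau k x * (g x - (\<Sum>i<length cs. of_rat (cs ! i) * x ^ i))"
      by (simp add: n test_fun_def algebra_simps)
    then have "\<bar>plateau k x * g x - test_seq n x\<bar>
        = plateau k x * \<bar>g x - (\<Sum>i<length cs. of_rat (cs ! i) * x ^ i)\<bar>"
      using plateau_bounds(1)[of k x] by (simp add: abs_mult)
    also have "\<dots> \<le> e * plateau k x"
    proof (cases "plateau k x = 0")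
      case False
      then have "\<bar>g x - (\<Sum>i<length cs. of_rat (cs ! i) * x ^ i)\<bar> \<le> e"
        using cs[of x] plateau_support[of k x] by simp
      then show ?thesis
        using mult_left_mono[OF _ plateau_bounds(1)[of k x]] by (simp only: mult.commute[of e])
    qed simp
    finally show ?thesis .
  qed
  then show ?thesis using n(1) by blast
qed

section \<open>The weighted space of continuous functions\<close>

lemma C0_dist_upper:
  assumes "admissible_weight v" "f \<in> C0_space v" "g \<in> C0_space v" "0 \<le> x"
  shows "\<bar>f x - g x\<bar> * v x \<le> C0_dist v f g"
  using cSUP_upper[OF _ C0_bdd_above[OF assms(1) C0_space_diff[OF assms(1-3)]], of x] assms
  by (simp add: C0_dist_def C0_norm_def)

lemma C0_dist_least:
  assumes "f \<in> C0_space v" "g \<in> C0_space v" "\<And>x. 0 \<le> x \<Longrightarrow> \<bar>f x - g x\<bar> * v x \<le> c"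
  shows "C0_dist v f g \<le> c"
  using assms by (auto simp: C0_dist_def C0_norm_def intro!: cSUP_least)

lemma C0_norm_cutoff_upper:
  assumes v: "admissible_weight v" and f: "f \<in> C0_space v" and t: "0 \<le> t" and x: "0 \<le> x" "x \<le> a"
  shows "\<bar>f (x + t)\<bar> * v x \<le> C0_norm v (cutoff a (left_translation t f))"
proof -
  have "bdd_above ((\<lambda>x. \<bar>left_translation t f x\<bar> * v x) ` {0..a})"
    by (rule bdd_above_mono[OF C0_bdd_above[OF v left_translation_C0_space[OF v t f]]]) auto
  also have "(\<lambda>x. \<bar>left_translation t f x\<bar> * v x) ` {0..a} = (\<lambda>x. \<bar>f (x + t)\<bar> * v x) ` {0..a}"
    by (rule image_cong) (auto simp: left_translation_def)
  finally show ?thesis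
    using cSUP_upper[of x "{0..a}" "\<lambda>x. \<bar>f (x + t)\<bar> * v x"] x
      C0_norm_cutoff_translation[OF v t _ f, of a] by simp
qed

lemma C0_norm_cutoff_least:
  assumes v: "admissible_weight v" and f: "f \<in> C0_space v" and "0 \<le> t" "0 \<le> a"
    and "\<And>x. 0 \<le> x \<Longrightarrow> x \<le> a \<Longrightarrow> \<bar>f (x + t)\<bar> * v x \<le> c"
  shows "C0_norm v (cutoff a (left_translation t f)) \<le> c"
  using assms by (auto simp: C0_norm_cutoff_translation intro!: cSUP_least)

text \<open>
  With \<open>c \<le> v\<close> everywhere and \<open>v \<le> K\<close> on \<open>[0, a]\<close>, the value \<open>\<bar>f (x + t)\<bar> v x\<close> is at most
  \<open>K / c\<close> times \<open>\<bar>f (x + t)\<bar> v (x + t)\<close>, and the latter tends to \<open>0\<close> by membership in the space.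
\<close>

lemma C0_cutoff_tendsto_0:
  assumes v: "admissible_weight v" and c: "0 < c" "\<And>x. 0 \<le> x \<Longrightarrow> c \<le> v x"
    and f: "f \<in> C0_space v" and a: "0 \<le> a"
  shows "((\<lambda>t. C0_norm v (cutoff a (left_translation t f))) \<longlongrightarrow> 0) at_top"
proof (rule tendstoI)
  fix e :: real assume e: "0 < e"
  obtain K where K: "\<And>x. x \<in> {0..a} \<Longrightarrow> v x \<le> K"
    using admissible_weight_bounded[OF v] by blast
  have K0: "0 < K" using K[of 0] a admissible_weight_pos[OF v, of 0] by simp
  have "((\<lambda>x. \<bar>f x\<bar> * v x) \<longlongrightarrow> 0) at_top" using f by (simp add: C0_space_def)
  then have "\<forall>\<^sub>F x in at_top. \<bar>f x\<bar> * v x < e / 2 * c / K"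
    by (rule order_tendstoD) (use e c K0 in simp)
  then obtain N where N: "\<And>x. N \<le> x \<Longrightarrow> \<bar>f x\<bar> * v x < e / 2 * c / K"
    by (auto simp: eventually_at_top_linorder)
  show "\<forall>\<^sub>F t in at_top. dist (C0_norm v (cutoff a (left_translation t f))) 0 < e"
    using eventually_ge_at_top[of "max 0 N"]
  proof eventually_elim
    fix t assume t: "max 0 N \<le> t"
    have "C0_norm v (cutoff a (left_translation t f)) \<le> e / 2"
    proof (rule C0_norm_cutoff_least[OF v f _ a])
      fix x assume x: "0 \<le> x" "x \<le> a"
      have "\<bar>f (x + t)\<bar> * c \<le> \<bar>f (x + t)\<bar> * v (x + t)"
        using c(2)[of "x + t"] x t by (intro mult_left_mono) auto
      also have "\<dots> < e / 2 * c / K" using N[of "x + t"] x t by simp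
      finally have "\<bar>f (x + t)\<bar> * K \<le> e / 2" using c K0 by (simp add: field_simps)
      moreover have "\<bar>f (x + t)\<bar> * v x \<le> \<bar>f (x + t)\<bar> * K"
        using K[of x] x by (intro mult_left_mono) auto
      ultimately show "\<bar>f (x + t)\<bar> * v x \<le> e / 2" by linarith
    qed (use t in auto)
    moreover have "0 \<le> C0_norm v (cutoff a (left_translation t f))"
    proof -
      have "0 \<le> \<bar>f (0 + t)\<bar> * v 0" using admissible_weight_pos[OF v, of 0] by simp
      also have "\<dots> \<le> C0_norm v (cutoff a (left_translation t f))"
        using t a by (intro C0_norm_cutoff_upper[OF v f]) auto
      finally show ?thesis .
    qed
    ultimately show "dist (C0_norm v (cutoff a (left_translation t f))) 0 < e"
      using e by simp
  qed
qed

lemma C0_space_compact_support: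
  assumes g: "continuous_on UNIV g" and supp: "\<And>x. b \<le> x \<Longrightarrow> g x = 0"
  shows "restrict g {0..} \<in> C0_space v"
proof -
  have "continuous_on {0..} g" using g continuous_on_subset by blast
  then have "continuous_on {0..} (restrict g {0..})" by (rule continuous_on_eq) simp
  moreover have "\<forall>\<^sub>F x in at_top. \<bar>restrict g {0..} x\<bar> * v x = 0"
    using eventually_ge_at_top[of "max 0 b"] by eventually_elim (use supp in simp)
  then have "((\<lambda>x. \<bar>restrict g {0..} x\<bar> * v x) \<longlongrightarrow> 0) at_top" by (rule tendsto_eventually)
  ultimately show ?thesis by (simp add: C0_space_def)
qed

lemma hypercyclic_C0_iff:
  assumes v: "admissible_weight v"
  shows "hypercyclic (C0_topology v) left_translation \<longleftrightarrow>
    (\<exists>f\<in>C0_space v. \<forall>g\<in>C0_space v. \<forall>e>0. \<exists>t\<ge>0. C0_dist v g (left_translation t f) < e)"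
  unfolding C0_topology_def
  by (rule hypercyclic_mtopology_iff[OF Metric_space_C0[OF v] left_translation_C0_space[OF v]])

text \<open>
  Bounded window norms already bound \<open>\<bar>f t\<bar> v 0\<close> uniformly in \<open>t\<close>, by some \<open>C\<close>. A function in the
  space whose value at \<open>0\<close> exceeds \<open>(C + 1) / v 0\<close> is then not within distance \<open>1\<close> of the orbit.
\<close>

lemma C0_hypercyclic_imp_not_tendsto:
  assumes v: "admissible_weight v" and hyp: "hypercyclic (C0_topology v) left_translation"
  shows "\<exists>f\<in>C0_space v. \<not> ((\<lambda>t. C0_norm v (cutoff 1 (left_translation t f))) \<longlongrightarrow> 0) at_top"
proof -
  obtain f where f: "f \<in> C0_space v" and
    dense: "\<And>g e. g \<in> C0_space v \<Longrightarrow> 0 < e \<Longrightarrow> \<exists>t\<ge>0. C0_dist v g (left_translation t f) < e"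
    using hyp unfolding hypercyclic_C0_iff[OF v] by blast
  have v0: "0 < v 0" using admissible_weight_pos[OF v, of 0] by simp
  have "\<not> ((\<lambda>t. C0_norm v (cutoff 1 (left_translation t f))) \<longlongrightarrow> 0) at_top"
  proof
    assume "((\<lambda>t. C0_norm v (cutoff 1 (left_translation t f))) \<longlongrightarrow> 0) at_top"
    then have "\<forall>\<^sub>F t in at_top. C0_norm v (cutoff 1 (left_translation t f)) < 1"
      by (rule order_tendstoD) simp
    then obtain N where N: "\<And>t. N \<le> t \<Longrightarrow> C0_norm v (cutoff 1 (left_translation t f)) < 1"
      by (auto simp: eventually_at_top_linorder)
    obtain M w where M: "1 \<le> M" and w: "0 \<le> w"
      and Mw: "\<forall>x\<ge>0. \<forall>s\<ge>0. v x \<le> M * exp (w * s) * v (x + s)"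
      using v by (rule admissible_weightE)
    obtain S where S: "\<And>x. 0 \<le> x \<Longrightarrow> \<bar>f x\<bar> * v x \<le> S"
      using C0_bdd_above[OF v f] by (auto simp: bdd_above_def)
    have S0: "0 \<le> S"
      using S[of 0] v0 by (meson abs_ge_zero less_imp_le mult_nonneg_nonneg order_refl order_trans)
    define C where "C = max 1 (M * exp (w * max 0 N) * S)"
    have C: "\<bar>f t\<bar> * v 0 \<le> C" if t: "0 \<le> t" for t
    proof (cases "N \<le> t")
      case True
      have "\<bar>f (0 + t)\<bar> * v 0 \<le> C0_norm v (cutoff 1 (left_translation t f))"
        using t by (intro C0_norm_cutoff_upper[OF v f]) auto
      then show ?thesis using N[OF True] by (simp add: C_def)
    next
      case False
      have "v 0 \<le> M * exp (w * t) * v (0 + t)" using Mw t by blast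
      then have "\<bar>f t\<bar> * v 0 \<le> \<bar>f t\<bar> * (M * exp (w * t) * v t)"
        by (intro mult_left_mono) auto
      also have "\<dots> = M * exp (w * t) * (\<bar>f t\<bar> * v t)" by simp
      also have "\<dots> \<le> M * exp (w * max 0 N) * S"
        using False t S[OF t] S0 M w admissible_weight_pos[OF v t]
        by (intro mult_mono) (auto intro!: mult_left_mono)
      finally show ?thesis by (simp add: C_def)
    qed
    define l where "l = (C + 2) / v 0"
    define g where "g = restrict (\<lambda>x. l * plateau 0 x) {0..}"
    have "continuous_on UNIV (\<lambda>x. l * plateau 0 x)"
      by (intro continuous_intros continuous_on_plateau)
    then have g: "g \<in> C0_space v"
      unfolding g_def by (rule C0_space_compact_support[of _ 2]) (auto simp: plateau_def)
    obtain t where t: "0 \<le> t" and close: "C0_dist v g (left_translation t f) < 1"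
      using dense[OF g, of 1] by auto
    have "\<bar>g 0 - left_translation t f 0\<bar> * v 0 < 1"
      using C0_dist_upper[OF v g left_translation_C0_space[OF v t f], of 0] close by simp
    then have "\<bar>l - f t\<bar> * v 0 < 1"
      by (simp add: g_def left_translation_def plateau_eq_1)
    moreover have "l * v 0 \<le> (\<bar>l - f t\<bar> + \<bar>f t\<bar>) * v 0"
      using v0 by (intro mult_right_mono) auto
    moreover have "l * v 0 = C + 2" using v0 by (simp add: l_def)
    ultimately show False using C[OF t] by (simp add: distrib_right)
  qed
  with f show ?thesis by blast
qed

text \<open>
  A given element is approximated in three steps: cutting it off by a plateau function, replacing the
  result by a test function, and replacing the test function by a translate of the universal
  function.
\<close>

lemma C0_hypercyclic_if_null_liminf:
  assumes v: "admissible_weight v" and nl: "null_liminf v"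
  shows "hypercyclic (C0_topology v) left_translation"
proof -
  obtain f s where f: "continuous_on UNIV f" and s0: "s 0 = 0"
    and gap: "\<And>m. s m + test_end m + 2 \<le> s (Suc m)"
    and err: "\<And>n y. 0 \<le> y \<Longrightarrow> f (y + s n) = test_seq n y \<or> 
        (\<exists>m>n. s m - s n - 1 \<le> y \<and> y \<le> s m - s n + test_end m \<and>
           \<bar>f (y + s n) - test_seq n y\<bar> powr 1 * v y \<le> (1 / 2) ^ m / (test_end m + 1))"
  proof (rule universal_function[OF v nl, of test_seq test_end 1])
    show "- 1 \<le> y \<and> y \<le> test_end m" if "test_seq m y \<noteq> 0" for m y
      using that by (rule test_seq_support)
  qed (rule continuous_on_test_seq test_end_nonneg zero_le_one that; assumption)+
  have "s m \<le> s (Suc m)" for m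
    using gap[of m] test_end_nonneg[of m] by linarith
  then have mono: "s m \<le> s n" if "m \<le> n" for m n
    using that by (rule lift_Suc_mono_le)
  have half: "(1 / 2) ^ m / (test_end m + 1) \<le> (1 / 2 :: real) ^ m" for m
    using test_end_nonneg[of m] by (simp add: divide_le_eq mult_le_cancel_left1)
  have err': "f (y + s n) = test_seq n y \<or> 
        (\<exists>m>n. y \<le> s m - s n + test_end m \<and> \<bar>f (y + s n) - test_seq n y\<bar> * v y \<le> (1 / 2) ^ m)"
    if "0 \<le> y" for n y
    using err[OF that, of n] half by (auto intro: order_trans)
  have small: "\<bar>f (y + s n) - test_seq n y\<bar> * v y \<le> (1 / 2) ^ n" if "0 \<le> y" for n y
    using err'[OF that, of n]
  proof
    assume "\<exists>m>n. y \<le> s m - s n + test_end m \<and> \<bar>f (y + s n) - test_seq n y\<bar> * v y \<le> (1 / 2) ^ m"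
    then obtain m where "n < m" "\<bar>f (y + s n) - test_seq n y\<bar> * v y \<le> (1 / 2) ^ m" by blast
    moreover have "(1 / 2 :: real) ^ m \<le> (1 / 2) ^ n"
      using \<open>n < m\<close> by (intro power_decreasing) auto
    ultimately show ?thesis by linarith
  qed simp
  \<comment> \<open>Beyond \<open>s k\<close> only bumps of index at least \<open>k\<close> occur.\<close>
  have F: "restrict f {0..} \<in> C0_space v"
  proof -
    have "continuous_on {0..} f" using f continuous_on_subset by blast
    then have "continuous_on {0..} (restrict f {0..})" by (rule continuous_on_eq) simp
    moreover have "((\<lambda>x. \<bar>restrict f {0..} x\<bar> * v x) \<longlongrightarrow> 0) at_top"
    proof (rule tendstoI)
      fix e :: real assume "0 < e"
      then obtain k where k: "(1 / 2) ^ k < e" using real_arch_pow_inv[of e "1/2"] by auto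
      show "\<forall>\<^sub>F x in at_top. dist (\<bar>restrict f {0..} x\<bar> * v x) 0 < e"
        using eventually_gt_at_top[of "max 0 (s k)"]
      proof eventually_elim
        fix x assume x: "max 0 (s k) < x"
        have "\<bar>f x\<bar> * v x \<le> (1 / 2) ^ k"
        proof (cases "f x = 0")
          case False
          then obtain m where m: "x \<le> s m + test_end m" "\<bar>f x\<bar> * v x \<le> (1 / 2) ^ m"
            using err'[of x 0] x by (auto simp: s0 test_seq_def)
          have "k \<le> m"
          proof (rule ccontr)
            assume "\<not> k \<le> m"
            then have "s (Suc m) \<le> s k" by (intro mono) simp
            then show False using gap[of m] m x by linarith
          qed
          then have "(1 / 2 :: real) ^ m \<le> (1 / 2) ^ k" by (intro power_decreasing) auto
          then show ?thesis using m by linarith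
        qed simp
        then show "dist (\<bar>restrict f {0..} x\<bar> * v x) 0 < e"
          using k x admissible_weight_pos[OF v, of x] by (simp add: abs_mult)
      qed
    qed
    ultimately show ?thesis by (simp add: C0_space_def)
  qed
  show ?thesis
    unfolding hypercyclic_C0_iff[OF v]
  proof (intro bexI[OF _ F] ballI allI impI)
    fix G and e :: real assume G: "G \<in> C0_space v" and e: "0 < e"
    have "\<forall>\<^sub>F x in at_top. \<bar>G x\<bar> * v x < e / 4"
      by (rule order_tendstoD) (use G e in \<open>auto simp: C0_space_def\<close>)
    then obtain N where N: "\<And>x. N \<le> x \<Longrightarrow> \<bar>G x\<bar> * v x < e / 4"
      by (auto simp: eventually_at_top_linorder)
    obtain k :: nat where k: "N \<le> real k" using real_arch_simple by blast
    obtain K where K: "\<And>x. x \<in> {0..real k + 1} \<Longrightarrow> v x \<le> K"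
      using admissible_weight_bounded[OF v] by blast
    have K0: "0 < K" using K[of 0] admissible_weight_pos[OF v, of 0] by simp
    define d where "d = e / (4 * K)"
    have d: "0 < d" using e K0 by (simp add: d_def)
    have "continuous_on UNIV (\<lambda>x. G (max 0 x))"
      by (rule continuous_on_compose2[of "{0..}" G])
         (use G in \<open>auto simp: C0_space_def intro!: continuous_intros\<close>)
    obtain j where j: "(1 / 2) ^ j < e / 4" using real_arch_pow_inv[of "e / 4" "1/2"] e by auto
    obtain n where n: "j \<le> n"
      "\<And>x. \<bar>plateau k x * G (max 0 x) - test_seq n x\<bar> \<le> d * plateau k x"
      using test_seq_dense[OF \<open>continuous_on UNIV (\<lambda>x. G (max 0 x))\<close> d, of j k] by blast
    have "(1 / 2 :: real) ^ n \<le> (1 / 2) ^ j" using n by (intro power_decreasing) auto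
    then have n4: "(1 / 2) ^ n \<le> e / 4" using j by linarith
    have t: "0 \<le> s n" using mono[of 0 n] s0 by simp
    have "C0_dist v G (left_translation (s n) (restrict f {0..})) \<le> 3 * e / 4"
    proof (rule C0_dist_least[OF G left_translation_C0_space[OF v t F]])
      fix x :: real assume x: "0 \<le> x"
      have vx: "0 < v x" by (rule admissible_weight_pos[OF v x])
      have 1: "\<bar>G x - plateau k x * G x\<bar> * v x \<le> e / 4"
      proof (cases "x \<le> real k")
        case True
        then show ?thesis using e x by (simp add: plateau_eq_1)
      next
        case False
        have "G x - plateau k x * G x = (1 - plateau k x) * G x"
          by (simp add: left_diff_distrib)
        then have "\<bar>G x - plateau k x * G x\<bar> = (1 - plateau k x) * \<bar>G x\<bar>"
          using plateau_bounds[of k x] by (simp add: abs_mult)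
        also have "\<dots> \<le> 1 * \<bar>G x\<bar>"
          using plateau_bounds[of k x] by (intro mult_right_mono) auto
        finally have "\<bar>G x - plateau k x * G x\<bar> * v x \<le> \<bar>G x\<bar> * v x"
          using vx by (intro mult_right_mono) auto
        then show ?thesis using N[of x] False k by simp
      qed
      have 2: "\<bar>plateau k x * G x - test_seq n x\<bar> * v x \<le> e / 4"
      proof -
        have "\<bar>plateau k x * G x - test_seq n x\<bar> * v x \<le> d * plateau k x * v x"
          using n(2)[of x] x vx by (intro mult_right_mono) auto
        also have "plateau k x * v x \<le> K"
        proof (cases "plateau k x = 0")
          case False
          then have "x \<in> {0..real k + 1}" using plateau_support[of k x] x by simp
          then have "plateau k x * v x \<le> 1 * K"
            using K plateau_bounds[of k x] vx by (intro mult_mono) auto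
          then show ?thesis by simp
        qed (use K0 in simp)
        then have "d * plateau k x * v x \<le> d * K" using d by (simp add: mult.assoc)
        also have "d * K = e / 4" using K0 by (simp add: d_def)
        finally show ?thesis .
      qed
      have "\<bar>G x - f (x + s n)\<bar> * v x \<le> (\<bar>G x - plateau k x * G x\<bar> + 
          \<bar>plateau k x * G x - test_seq n x\<bar> + \<bar>f (x + s n) - test_seq n x\<bar>) * v x"
        using vx by (intro mult_right_mono) auto
      also have "\<dots> \<le> e / 4 + e / 4 + e / 4"
        using 1 2 small[OF x, of n] n4 by (simp add: distrib_right)
      finally show "\<bar>G x - left_translation (s n) (restrict f {0..}) x\<bar> * v x \<le> 3 * e / 4"
        using x t by (simp add: left_translation_def)
    qed
    also have "\<dots> < e" using e by simp
    finally show "\<exists>t\<ge>0. C0_dist v G (left_translation t (restrict f {0..})) < e"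
      using t by blast
  qed
qed

section \<open>The weighted Lebesgue spaces\<close>

abbreviation halfline :: "real measure" where
  "halfline \<equiv> lebesgue_on {0..}"

definition Lp_int :: "(real \<Rightarrow> real) \<Rightarrow> real \<Rightarrow> (real \<Rightarrow> real) \<Rightarrow> real" where
  "Lp_int v p u = (\<integral>x. \<bar>u x\<bar> powr p * v x \<partial>halfline)"

lemma Lp_fun_norm_eq: "Lp_fun_norm v p u = Lp_int v p u powr (1 / p)"
  by (simp add: Lp_fun_norm_def Lp_int_def)

lemma Lp_int_cong: "(\<And>x. 0 \<le> x \<Longrightarrow> u x = w x) \<Longrightarrow> Lp_int v p u = Lp_int v p w"
  unfolding Lp_int_def by (intro Bochner_Integration.integral_cong) auto

lemma Lp_fun_norm_cong_halfline:
  "(\<And>x. 0 \<le> x \<Longrightarrow> u x = w x) \<Longrightarrow> Lp_fun_norm v p u = Lp_fun_norm v p w"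
  unfolding Lp_fun_norm_eq by (simp cong: Lp_int_cong)

lemma restrict_Lp_fun_iff:
  "restrict u {0..} \<in> Lp_fun v p \<longleftrightarrow> u \<in> borel_measurable halfline \<and>
     integrable halfline (\<lambda>x. \<bar>u x\<bar> powr p * v x)"
proof -
  have "restrict u {0..} \<in> borel_measurable halfline \<longleftrightarrow> u \<in> borel_measurable halfline"
    by (rule measurable_cong) simp
  moreover have "integrable halfline (\<lambda>x. \<bar>restrict u {0..} x\<bar> powr p * v x) \<longleftrightarrow>
      integrable halfline (\<lambda>x. \<bar>u x\<bar> powr p * v x)"
    by (rule Bochner_Integration.integrable_cong) auto
  ultimately show ?thesis by (simp add: Lp_fun_def)
qed

lemma restrict_Lp_fun: "f \<in> Lp_fun v p \<Longrightarrow> restrict f {0..} = f"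
  by (simp add: Lp_fun_def extensional_restrict)

lemma Lp_int_nonneg:
  assumes v: "admissible_weight v"
  shows "0 \<le> Lp_int v p u"
  unfolding Lp_int_def
proof (rule integral_nonneg_AE, rule AE_I2)
  fix x assume "x \<in> space halfline"
  then have "0 < v x" using admissible_weight_pos[OF v] by simp
  then show "0 \<le> \<bar>u x\<bar> powr p * v x" by simp
qed

lemma Lp_fun_dominated:
  assumes v: "admissible_weight v" and u: "u \<in> borel_measurable halfline"
    and W: "integrable halfline W" and le: "\<And>x. 0 \<le> x \<Longrightarrow> \<bar>u x\<bar> powr p * v x \<le> W x"
  shows "restrict u {0..} \<in> Lp_fun v p" "Lp_int v p u \<le> integral\<^sup>L halfline W"
proof -
  have [measurable]: "u \<in> borel_measurable halfline" "v \<in> borel_measurable halfline"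
    using u admissible_weight_measurable[OF v] by auto
  have int: "integrable halfline (\<lambda>x. \<bar>u x\<bar> powr p * v x)"
  proof (rule Bochner_Integration.integrable_bound[OF W])
    show "AE x in halfline. norm (\<bar>u x\<bar> powr p * v x) \<le> norm (W x)"
    proof (rule AE_I2)
      fix x assume "x \<in> space halfline"
      then have x: "0 \<le> x" by simp
      then show "norm (\<bar>u x\<bar> powr p * v x) \<le> norm (W x)"
        using le[OF x] admissible_weight_pos[OF v x] by (simp add: abs_mult)
    qed
  qed measurable
  then show "restrict u {0..} \<in> Lp_fun v p" using u by (simp add: restrict_Lp_fun_iff)
  show "Lp_int v p u \<le> integral\<^sup>L halfline W"
    unfolding Lp_int_def by (rule integral_mono[OF int W]) (use le in auto)
qed

lemma integrable_weight_interval: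
  assumes "admissible_weight v" "0 \<le> b"
  shows "integrable halfline (\<lambda>x. indicator {0..b} x * v x)"
proof -
  have "integrable lebesgue (\<lambda>x. indicator {0..b} x * v x)"
    using assms by (simp add: admissible_weight_def set_integrable_def)
  then have "integrable lebesgue (\<lambda>x. indicator {0..} x *\<^sub>R (indicator {0..b} x * v x))"
    by (rule Bochner_Integration.integrable_cong[THEN iffD1, rotated 2]) (auto simp: indicator_def)
  then show ?thesis by (subst integrable_restrict_space) auto
qed

lemma Lp_fun_bounded_support:
  assumes v: "admissible_weight v" and p: "0 < p" and b: "0 \<le> b"
    and u: "u \<in> borel_measurable halfline"
    and bound: "\<And>x. 0 \<le> x \<Longrightarrow> \<bar>u x\<bar> \<le> B" and supp: "\<And>x. b < x \<Longrightarrow> u x = 0"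
  shows "restrict u {0..} \<in> Lp_fun v p"
    "Lp_int v p u \<le> B powr p * (\<integral>x. indicator {0..b} x * v x \<partial>halfline)"
proof -
  let ?W = "\<lambda>x. B powr p * (indicator {0..b} x * v x)"
  have W: "integrable halfline ?W"
    by (intro integrable_mult_right integrable_weight_interval v b)
  have le: "\<bar>u x\<bar> powr p * v x \<le> ?W x" if x: "0 \<le> x" for x
  proof (cases "x \<le> b")
    case True
    have "\<bar>u x\<bar> powr p * v x \<le> B powr p * v x"
      using bound[OF x] p admissible_weight_pos[OF v x] by (intro mult_right_mono powr_mono2) auto
    then show ?thesis using True x by simp
  next
    case False
    then show ?thesis using supp[of x] by simp
  qed
  show "restrict u {0..} \<in> Lp_fun v p"
    by (rule Lp_fun_dominated(1)[OF v u W le])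
  have "Lp_int v p u \<le> integral\<^sup>L halfline ?W"
    by (rule Lp_fun_dominated(2)[OF v u W le])
  then show "Lp_int v p u \<le> B powr p * (\<integral>x. indicator {0..b} x * v x \<partial>halfline)" by simp
qed

lemma Lp_fun_norm_less:
  assumes v: "admissible_weight v" and p: "1 \<le> p" and e: "0 < e" and le: "Lp_int v p u < e powr p"
  shows "Lp_fun_norm v p u < e"
proof -
  have "Lp_fun_norm v p u < (e powr p) powr (1 / p)"
    unfolding Lp_fun_norm_eq using le Lp_int_nonneg[OF v] p by (intro powr_less_mono2) auto
  then show ?thesis using p e by (simp add: powr_powr)
qed

lemma Lp_fun_norm_mono:
  assumes v: "admissible_weight v" and p: "1 \<le> p"
    and u: "u \<in> borel_measurable halfline" and w: "restrict w {0..} \<in> Lp_fun v p"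
    and le: "\<And>x. 0 \<le> x \<Longrightarrow> \<bar>u x\<bar> \<le> \<bar>w x\<bar>"
  shows "Lp_fun_norm v p u \<le> Lp_fun_norm v p w"
proof -
  have W: "integrable halfline (\<lambda>x. \<bar>w x\<bar> powr p * v x)"
    using w by (simp add: restrict_Lp_fun_iff)
  have "\<bar>u x\<bar> powr p * v x \<le> \<bar>w x\<bar> powr p * v x" if "0 \<le> x" for x
    using le[OF that] p admissible_weight_pos[OF v that] by (intro mult_right_mono powr_mono2) auto
  from Lp_fun_dominated(2)[OF v u W this] have "Lp_int v p u \<le> Lp_int v p w"
    by (simp add: Lp_int_def)
  then show ?thesis
    unfolding Lp_fun_norm_eq using Lp_int_nonneg[OF v] p by (intro powr_mono2) auto
qed

text \<open>
  The triangle inequality in the metric space of equivalence classes, read off for representatives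
  given by arbitrary functions on the reals.
\<close>

lemma Lp_fun_norm_triangle:
  assumes v: "admissible_weight v" and p: "1 \<le> p"
    and f: "restrict f {0..} \<in> Lp_fun v p" and g: "restrict g {0..} \<in> Lp_fun v p"
    and h: "restrict h {0..} \<in> Lp_fun v p"
  shows "Lp_fun_norm v p (\<lambda>x. f x - h x) \<le>
    Lp_fun_norm v p (\<lambda>x. f x - g x) + Lp_fun_norm v p (\<lambda>x. g x - h x)"
proof -
  interpret Metric_space "Lp_space v p" "Lp_dist v p" by (rule Metric_space_Lp[OF v p])
  let ?c = "\<lambda>f. Lp_eq v p `` {restrict f {0..}}"
  have "?c k \<in> Lp_space v p" if "restrict k {0..} \<in> Lp_fun v p" for k
    using that by (simp add: Lp_space_def quotientI)
  then have "Lp_dist v p (?c f) (?c h) \<le> Lp_dist v p (?c f) (?c g) + Lp_dist v p (?c g) (?c h)"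
    using f g h by (intro triangle) auto
  moreover have "Lp_dist v p (?c k) (?c l) = Lp_fun_norm v p (\<lambda>x. k x - l x)"
    if "restrict k {0..} \<in> Lp_fun v p" "restrict l {0..} \<in> Lp_fun v p" for k l
    unfolding Lp_dist_class[OF v p that] by (rule Lp_fun_norm_cong_halfline) simp
  ultimately show ?thesis using f g h by simp
qed

lemma Lp_space_rep: "F \<in> Lp_space v p \<Longrightarrow> \<exists>f\<in>Lp_fun v p. F = Lp_eq v p `` {f}"
  by (auto simp: Lp_space_def elim!: quotientE)

text \<open>
  The orbit of a class consists of the classes of the translates of any representative, and
  distances of classes are norms of differences of representatives.
\<close>

lemma hypercyclic_Lp_iff:
  assumes v: "admissible_weight v" and p: "1 \<le> p"
  shows "hypercyclic (Lp_topology v p) (Lp_translation v p) \<longleftrightarrow>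
    (\<exists>f\<in>Lp_fun v p. \<forall>g\<in>Lp_fun v p. \<forall>e>0. \<exists>t\<ge>0. Lp_fun_norm v p (\<lambda>x. g x - f (x + t)) < e)"
proof -
  have inv: "Lp_translation v p t F \<in> Lp_space v p" if t: "0 \<le> t" and F: "F \<in> Lp_space v p" for t F
  proof -
    obtain f where f: "f \<in> Lp_fun v p" "F = Lp_eq v p `` {f}" using Lp_space_rep[OF F] by blast
    then show ?thesis
      by (simp add: Lp_translation_class[OF v t] Lp_space_def quotientI left_translation_Lp_fun[OF v t])
  qed
  have dist: "Lp_dist v p (Lp_eq v p `` {g}) (Lp_translation v p t (Lp_eq v p `` {f})) =
      Lp_fun_norm v p (\<lambda>x. g x - f (x + t))"
    if "f \<in> Lp_fun v p" "g \<in> Lp_fun v p" "0 \<le> t" for f g t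
    unfolding Lp_translation_class[OF v that(3,1)]
      Lp_dist_class[OF v p that(2) left_translation_Lp_fun[OF v that(3,1)]]
    by (rule Lp_fun_norm_cong_halfline) (simp add: left_translation_def)
  have all: "(\<forall>G\<in>Lp_space v p. P G) \<longleftrightarrow> (\<forall>g\<in>Lp_fun v p. P (Lp_eq v p `` {g}))" for P
    using Lp_space_rep by (auto simp: Lp_space_def quotientI)
  have ex: "(\<exists>G\<in>Lp_space v p. P G) \<longleftrightarrow> (\<exists>g\<in>Lp_fun v p. P (Lp_eq v p `` {g}))" for P
    using all[of "\<lambda>G. \<not> P G"] by blast
  have "hypercyclic (Lp_topology v p) (Lp_translation v p) \<longleftrightarrow>
      (\<exists>F\<in>Lp_space v p. \<forall>G\<in>Lp_space v p. \<forall>e>0. \<exists>t\<ge>0. Lp_dist v p G (Lp_translation v p t F) < e)"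
    unfolding Lp_topology_def by (rule hypercyclic_mtopology_iff[OF Metric_space_Lp[OF v p] inv])
  also have "\<dots> \<longleftrightarrow> (\<exists>f\<in>Lp_fun v p. \<forall>g\<in>Lp_fun v p. \<forall>e>0. \<exists>t\<ge>0.
      Lp_dist v p (Lp_eq v p `` {g}) (Lp_translation v p t (Lp_eq v p `` {f})) < e)"
    unfolding ex all ..
  also have "\<dots> \<longleftrightarrow> (\<exists>f\<in>Lp_fun v p. \<forall>g\<in>Lp_fun v p. \<forall>e>0. \<exists>t\<ge>0.
      Lp_fun_norm v p (\<lambda>x. g x - f (x + t)) < e)"
    by (intro bex_cong ball_cong refl all_cong ex_cong conj_cong) (simp add: dist)
  finally show ?thesis .
qed

text \<open>
  A substitution in the integral. It is used with two kinds of \<open>D\<close>: with the factor of the growth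
  condition, to bound window norms for \<open>t\<close> in a bounded set, and with the ratio of an upper bound of
  \<open>v\<close> on \<open>[0, a]\<close> to a global lower bound, which is independent of \<open>t\<close>.
\<close>

lemma Lp_translation_tail_estimate:
  assumes v: "admissible_weight v" and f: "f \<in> Lp_fun v p" and t: "0 \<le> t" and D: "0 \<le> D"
    and le: "\<And>x. 0 \<le> x \<Longrightarrow> x \<le> a \<Longrightarrow> v x \<le> D * v (x + t)"
  shows "(\<integral>x. \<bar>f (x + t)\<bar> powr p * v x \<partial>lebesgue_on {0..a}) \<le>
    D * (\<integral>x. indicator {t..} x * (\<bar>f x\<bar> powr p * v x) \<partial>halfline)"
proof -
  have int: "integrable halfline (\<lambda>x. \<bar>f x\<bar> powr p * v x)"
    using f by (simp add: Lp_fun_def)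
  define k where "k x = indicator {t..} x * (\<bar>f x\<bar> powr p * v x)" for x
  have k0: "0 \<le> k x" for x
    using admissible_weight_pos[OF v, of x] t by (auto simp: k_def indicator_def)
  have "integrable halfline k"
    unfolding k_def
    using integrable_mult_indicator[OF _ int, of "{t..}"] t
    by (auto simp: sets_restrict_space_iff)
  then have "integrable lebesgue (\<lambda>x. indicator {0..} x *\<^sub>R k x)"
    by (subst (asm) integrable_restrict_space) auto
  moreover have ind: "indicator {0..} x *\<^sub>R k x = k x" for x
    using t by (auto simp: k_def indicator_def)
  ultimately have k: "integrable lebesgue k" by (simp only: ind)
  have kt: "integrable lebesgue (\<lambda>x. k (x + t))"
  proof (rule integrable_distr[OF measurable_lebesgue_translation])
    show "integrable (distr lebesgue lebesgue (\<lambda>x. x + t)) k"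
      using k by (simp only: distr_lebesgue_translation)
  qed
  have "(\<integral>x. \<bar>f (x + t)\<bar> powr p * v x \<partial>lebesgue_on {0..a}) =
      (\<integral>x. indicator {0..a} x *\<^sub>R (\<bar>f (x + t)\<bar> powr p * v x) \<partial>lebesgue)"
    by (rule integral_restrict_space) auto
  also have "\<dots> \<le> (\<integral>x. D * k (x + t) \<partial>lebesgue)"
  proof (rule integral_mono')
    show "integrable lebesgue (\<lambda>x. D * k (x + t))" using kt by simp
    show "0 \<le> D * k (x + t)" for x using D k0 by simp
    show "indicator {0..a} x *\<^sub>R (\<bar>f (x + t)\<bar> powr p * v x) \<le> D * k (x + t)" for x
    proof (cases "x \<in> {0..a}")
      case True
      then have "\<bar>f (x + t)\<bar> powr p * v x \<le> \<bar>f (x + t)\<bar> powr p * (D * v (x + t))"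
        by (intro mult_left_mono le) auto
      then show ?thesis using True t by (simp add: k_def algebra_simps)
    next
      case False
      then show ?thesis using D k0[of "x + t"] by simp
    qed
  qed
  also have "\<dots> = D * (\<integral>x. k (x + t) \<partial>lebesgue)" by simp
  also have "(\<integral>x. k (x + t) \<partial>lebesgue) = (\<integral>x. k x \<partial>distr lebesgue lebesgue (\<lambda>x. x + t))"
    by (rule integral_distr[symmetric, OF measurable_lebesgue_translation])
       (use k in \<open>auto dest: borel_measurable_integrable\<close>)
  also have "\<dots> = (\<integral>x. k x \<partial>lebesgue)"
    by (simp only: distr_lebesgue_translation)
  also have "\<dots> = (\<integral>x. k x \<partial>halfline)"
    by (subst integral_restrict_space) (simp, simp only: ind)
  finally show ?thesis by (simp add: k_def)
qed

text \<open>
  The tail integrals of an integrable function tend to \<open>0\<close>, and the preceding estimate bounds the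
  window norms by them with a constant independent of \<open>t\<close>.
\<close>

lemma Lp_cutoff_tendsto_0:
  assumes v: "admissible_weight v" and p: "1 \<le> p" and c: "0 < c" "\<And>x. 0 \<le> x \<Longrightarrow> c \<le> v x"
    and F: "F \<in> Lp_space v p"
  shows "((\<lambda>t. Lp_norm v p (Lp_cutoff v p a (Lp_translation v p t F))) \<longlongrightarrow> 0) at_top"
proof -
  obtain f where f: "f \<in> Lp_fun v p" and Ff: "F = Lp_eq v p `` {f}" using Lp_space_rep[OF F] by blast
  obtain K where K: "\<And>x. x \<in> {0..a} \<Longrightarrow> v x \<le> K"
    using admissible_weight_bounded[OF v] by blast
  define D where "D = max 0 K / c"
  have D: "0 \<le> D" using c by (simp add: D_def)
  have int: "integrable halfline (\<lambda>x. \<bar>f x\<bar> powr p * v x)"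
    using f by (simp add: Lp_fun_def)
  let ?J = "\<lambda>t. \<integral>x. \<bar>f (x + t)\<bar> powr p * v x \<partial>lebesgue_on {0..a}"
  have J0: "0 \<le> ?J t" for t
  proof (rule integral_nonneg_AE, rule AE_I2)
    fix x assume "x \<in> space (lebesgue_on {0..a})"
    then have "0 < v x" using admissible_weight_pos[OF v] by simp
    then show "0 \<le> \<bar>f (x + t)\<bar> powr p * v x" by simp
  qed
  have "((\<lambda>t. \<integral>x. indicator {t..} x * (\<bar>f x\<bar> powr p * v x) \<partial>halfline) \<longlongrightarrow> (\<integral>x. 0 \<partial>halfline)) at_top"
  proof (rule integral_dominated_convergence_at_top)
    show "integrable halfline (\<lambda>x. norm (\<bar>f x\<bar> powr p * v x))" using int by (rule integrable_norm)
    show "(\<lambda>x. indicator {t..} x * (\<bar>f x\<bar> powr p * v x)) \<in> borel_measurable halfline" for t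
    proof (rule borel_measurable_times[OF _ borel_measurable_integrable[OF int]])
      show "(\<lambda>x. indicator {t..} x :: real) \<in> borel_measurable halfline"
        by (intro measurable_restrict_space1 borel_measurable_indicator) simp
    qed
    show "\<forall>\<^sub>F t in at_top. AE x in halfline. norm (indicator {t..} x * (\<bar>f x\<bar> powr p * v x))
        \<le> norm (\<bar>f x\<bar> powr p * v x)"
      by (intro always_eventually allI AE_I2) (auto simp: indicator_def)
    have "((\<lambda>t. indicator {t..} x * (\<bar>f x\<bar> powr p * v x)) \<longlongrightarrow> 0) at_top" for x
      by (rule tendsto_eventually, rule eventually_mono[OF eventually_gt_at_top[of x]]) simp
    then show "AE x in halfline. ((\<lambda>t. indicator {t..} x * (\<bar>f x\<bar> powr p * v x)) \<longlongrightarrow> 0) at_top"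
      by simp
  qed simp
  then have "((\<lambda>t. D * (\<integral>x. indicator {t..} x * (\<bar>f x\<bar> powr p * v x) \<partial>halfline)) \<longlongrightarrow> 0) at_top"
    by (intro tendsto_mult_right_zero) simp
  then have "(?J \<longlongrightarrow> 0) at_top"
  proof (rule tendsto_sandwich[OF _ _ tendsto_const, rotated 2])
    show "\<forall>\<^sub>F t in at_top. 0 \<le> ?J t" using J0 by simp
    show "\<forall>\<^sub>F t in at_top. ?J t \<le> D * (\<integral>x. indicator {t..} x * (\<bar>f x\<bar> powr p * v x) \<partial>halfline)"
      using eventually_ge_at_top[of 0]
    proof eventually_elim
      fix t :: real assume t: "0 \<le> t"
      show "?J t \<le> D * (\<integral>x. indicator {t..} x * (\<bar>f x\<bar> powr p * v x) \<partial>halfline)"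
      proof (rule Lp_translation_tail_estimate[OF v f t D])
        fix x assume x: "0 \<le> x" "x \<le> a"
        have "v x \<le> D * c" using K[of x] x c by (simp add: D_def)
        also have "\<dots> \<le> D * v (x + t)" using c(2)[of "x + t"] x t D by (intro mult_left_mono) auto
        finally show "v x \<le> D * v (x + t)" .
      qed
    qed
  qed
  then have "((\<lambda>t. ?J t powr (1 / p)) \<longlongrightarrow> 0 powr (1 / p)) at_top"
    using p J0 by (intro tendsto_powr') auto
  then have "((\<lambda>t. ?J t powr (1 / p)) \<longlongrightarrow> 0) at_top" using p by simp
  moreover have "\<forall>\<^sub>F t in at_top. ?J t powr (1 / p) = Lp_norm v p (Lp_cutoff v p a (Lp_translation v p t F))"
    using eventually_ge_at_top[of 0]
    by eventually_elim (simp add: Ff Lp_norm_cutoff_translation[OF v p _ f])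
  ultimately show ?thesis by (rule Lim_transform_eventually)
qed

text \<open>
  If all window norms were at most \<open>C\<close>, then a multiple of the characteristic function of \<open>[0, 1]\<close>
  of norm at least \<open>C + 2\<close> would have distance at least \<open>2\<close> from the orbit, because the distance
  does not increase when the translate is cut off at \<open>1\<close>.
\<close>

lemma Lp_hypercyclic_imp_not_tendsto:
  assumes v: "admissible_weight v" and p: "1 \<le> p"
    and hyp: "hypercyclic (Lp_topology v p) (Lp_translation v p)"
  shows "\<exists>F\<in>Lp_space v p. 
    \<not> ((\<lambda>t. Lp_norm v p (Lp_cutoff v p 1 (Lp_translation v p t F))) \<longlongrightarrow> 0) at_top"
proof -
  obtain f where f: "f \<in> Lp_fun v p" and
    dense: "\<And>g e. g \<in> Lp_fun v p \<Longrightarrow> 0 < e \<Longrightarrow> \<exists>t\<ge>0. Lp_fun_norm v p (\<lambda>x. g x - f (x + t)) < e"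
    using hyp unfolding hypercyclic_Lp_iff[OF v p] by blast
  let ?N = "\<lambda>t. Lp_norm v p (Lp_cutoff v p 1 (Lp_translation v p t (Lp_eq v p `` {f})))"
  obtain M w where M: "1 \<le> M" and w: "0 \<le> w"
    and Mw: "\<forall>x\<ge>0. \<forall>s\<ge>0. v x \<le> M * exp (w * s) * v (x + s)"
    using v by (rule admissible_weightE)
  have norm_eq: "?N t = Lp_fun_norm v p (cutoff 1 (left_translation t f))" if t: "0 \<le> t" for t
    using left_translation_Lp_fun[OF v t f]
    by (simp add: Lp_translation_class[OF v t f] Lp_cutoff_class[OF v p] Lp_norm_class[OF v]
        cutoff_Lp_fun[OF v p])
  have "\<not> (?N \<longlongrightarrow> 0) at_top"
  proof
    assume "(?N \<longlongrightarrow> 0) at_top"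
    then have "\<forall>\<^sub>F t in at_top. ?N t < 1"
      by (rule order_tendstoD) simp
    then obtain T where T: "\<And>t. T \<le> t \<Longrightarrow> ?N t < 1"
      by (auto simp: eventually_at_top_linorder)
    have int: "integrable halfline (\<lambda>x. \<bar>f x\<bar> powr p * v x)"
      using f by (simp add: Lp_fun_def)
    define C where "C = max 1 ((M * exp (w * max 0 T) * Lp_int v p f) powr (1 / p))"
    have C: "Lp_fun_norm v p (cutoff 1 (left_translation t f)) \<le> C" if t: "0 \<le> t" for t
    proof (cases "T \<le> t")
      case True
      then show ?thesis using T[OF True] norm_eq[OF t] by (simp add: C_def)
    next
      case False
      have "(\<integral>x. \<bar>f (x + t)\<bar> powr p * v x \<partial>lebesgue_on {0..1}) \<le>
          M * exp (w * t) * (\<integral>x. indicator {t..} x * (\<bar>f x\<bar> powr p * v x) \<partial>halfline)"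
        by (rule Lp_translation_tail_estimate[OF v f t]) (use Mw M t in auto)
      also have "\<dots> \<le> M * exp (w * max 0 T) * Lp_int v p f"
      proof (rule mult_mono)
        show "(\<integral>x. indicator {t..} x * (\<bar>f x\<bar> powr p * v x) \<partial>halfline) \<le> Lp_int v p f"
          unfolding Lp_int_def
        proof (rule integral_mono_AE', rule int)
          have nn: "0 \<le> \<bar>f x\<bar> powr p * v x" if "x \<in> space halfline" for x
            using that admissible_weight_pos[OF v, of x] by simp
          show "AE x in halfline. indicator {t..} x * (\<bar>f x\<bar> powr p * v x) \<le> \<bar>f x\<bar> powr p * v x"
            by (rule AE_I2) (use nn in \<open>simp add: indicator_def\<close>)
          show "AE x in halfline. 0 \<le> \<bar>f x\<bar> powr p * v x"
            by (rule AE_I2) (rule nn)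
        qed
        show "M * exp (w * t) \<le> M * exp (w * max 0 T)"
          using False M w by (auto intro!: mult_left_mono)
        show "0 \<le> M * exp (w * max 0 T)" using M by simp
        show "0 \<le> (\<integral>x. indicator {t..} x * (\<bar>f x\<bar> powr p * v x) \<partial>halfline)"
        proof (rule integral_nonneg_AE, rule AE_I2)
          fix x assume "x \<in> space halfline"
          then have "0 < v x" using admissible_weight_pos[OF v] by simp
          then show "0 \<le> indicator {t..} x * (\<bar>f x\<bar> powr p * v x)" by simp
        qed
      qed
      finally have "?N t \<le> (M * exp (w * max 0 T) * Lp_int v p f) powr (1 / p)"
        unfolding Lp_norm_cutoff_translation[OF v p t f]
      proof (intro powr_mono2)
        show "0 \<le> (\<integral>x. \<bar>f (x + t)\<bar> powr p * v x \<partial>lebesgue_on {0..1})"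
        proof (rule integral_nonneg_AE, rule AE_I2)
          fix x assume "x \<in> space (lebesgue_on {0..1::real})"
          then have "0 < v x" using admissible_weight_pos[OF v] by simp
          then show "0 \<le> \<bar>f (x + t)\<bar> powr p * v x" by simp
        qed
      qed (use p in auto)
      then show ?thesis using norm_eq[OF t] by (simp add: C_def)
    qed
    \<comment> \<open>A lower bound for \<open>v\<close> on \<open>[0, 1]\<close>: \<open>l\<close> times the characteristic function of \<open>[0, 1]\<close> has
      norm at least \<open>l c\<^sup>1\<^sup>/\<^sup>p\<close>.\<close>
    define c where "c = v 0 / (M * exp w)"
    have c: "0 < c" using M admissible_weight_pos[OF v, of 0] by (simp add: c_def)
    have vc: "c \<le> v x" if x: "0 \<le> x" "x \<le> 1" for x
    proof -
      have "v 0 \<le> M * exp (w * x) * v (0 + x)" using Mw x by blast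
      also have "\<dots> \<le> M * exp w * v x"
        using x M w admissible_weight_pos[OF v x(1)]
        by (intro mult_mono) (auto intro!: mult_left_mono simp: mult_left_le)
      finally show ?thesis using M by (simp add: c_def field_simps)
    qed
    define l where "l = (C + 2) / c powr (1 / p)"
    have l: "0 \<le> l" using c by (simp add: l_def C_def)
    define g where "g = (\<lambda>x::real. l * indicator {0..1} x)"
    have g_meas: "g \<in> borel_measurable halfline"
      unfolding g_def by (intro borel_measurable_times borel_measurable_const borel_measurable_indicator)
        (auto simp: sets_restrict_space_iff)
    have g: "restrict g {0..} \<in> Lp_fun v p"
      by (rule Lp_fun_bounded_support(1)[OF v _ zero_le_one g_meas, of _ l])
         (use p l in \<open>auto simp: g_def indicator_def\<close>)
    have gnorm: "C + 2 \<le> Lp_fun_norm v p g"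
    proof -
      have "l powr p * c = (\<integral>x. l powr p * (c * indicator {0..1} x) \<partial>halfline)"
      proof -
        have "(\<integral>x. indicator {0..1} x \<partial>halfline) = (1::real)"
          by (simp add: measure_restrict_space)
        then show ?thesis by simp
      qed
      also have "\<dots> \<le> Lp_int v p g"
        unfolding Lp_int_def
      proof (rule integral_mono_AE')
        show "integrable halfline (\<lambda>x. \<bar>g x\<bar> powr p * v x)"
          using g by (simp add: restrict_Lp_fun_iff)
        show "AE x in halfline. l powr p * (c * indicator {0..1} x) \<le> \<bar>g x\<bar> powr p * v x"
          by (rule AE_I2) (use vc l p in \<open>auto simp: g_def indicator_def intro!: mult_left_mono\<close>)
        show "AE x in halfline. 0 \<le> \<bar>g x\<bar> powr p * v x"
        proof (rule AE_I2)
          fix x assume "x \<in> space halfline"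
          then show "0 \<le> \<bar>g x\<bar> powr p * v x" using admissible_weight_pos[OF v, of x] by simp
        qed
      qed
      finally have "(l powr p * c) powr (1 / p) \<le> Lp_fun_norm v p g"
        unfolding Lp_fun_norm_eq using c p by (intro powr_mono2) auto
      moreover have "(l powr p * c) powr (1 / p) = l * c powr (1 / p)"
        using l c p by (simp add: powr_mult powr_powr)
      moreover have "l * c powr (1 / p) = C + 2" using c by (simp add: l_def)
      ultimately show ?thesis by simp
    qed
    obtain t where t: "0 \<le> t" and "Lp_fun_norm v p (\<lambda>x. restrict g {0..} x - f (x + t)) < 1"
      using dense[OF g, of 1] by auto
    then have close: "Lp_fun_norm v p (\<lambda>x. g x - left_translation t f x) < 1"
      by (subst (asm) Lp_fun_norm_cong_halfline[of _ "\<lambda>x. g x - left_translation t f x"])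
         (auto simp: left_translation_def)
    define u where "u = left_translation t f"
    have u: "u \<in> Lp_fun v p" unfolding u_def by (rule left_translation_Lp_fun[OF v t f])
    have cu: "cutoff 1 u \<in> Lp_fun v p" by (rule cutoff_Lp_fun[OF v p u])
    have zero: "restrict (\<lambda>x. 0) {0..} \<in> Lp_fun v p" by (simp add: restrict_Lp_fun_iff)
    have "Lp_fun_norm v p (\<lambda>x. g x - 0) \<le>
        Lp_fun_norm v p (\<lambda>x. g x - cutoff 1 u x) + Lp_fun_norm v p (\<lambda>x. cutoff 1 u x - 0)"
      by (rule Lp_fun_norm_triangle[OF v p g _ zero]) (simp add: restrict_Lp_fun[OF cu] cu)
    also have "Lp_fun_norm v p (\<lambda>x. g x - cutoff 1 u x) \<le> Lp_fun_norm v p (\<lambda>x. g x - u x)"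
    proof (rule Lp_fun_norm_mono[OF v p])
      show "(\<lambda>x. g x - cutoff 1 u x) \<in> borel_measurable halfline"
        using g_meas cu by (auto simp: Lp_fun_def)
      have "restrict (\<lambda>x. restrict g {0..} x - u x) {0..} \<in> Lp_fun v p"
        by (rule Lp_fun_diff(1)[OF v p g u])
      also have "restrict (\<lambda>x. restrict g {0..} x - u x) {0..} = restrict (\<lambda>x. g x - u x) {0..}"
        by auto
      finally show "restrict (\<lambda>x. g x - u x) {0..} \<in> Lp_fun v p" .
      show "\<bar>g x - cutoff 1 u x\<bar> \<le> \<bar>g x - u x\<bar>" if "0 \<le> x" for x
        using that by (auto simp: g_def cutoff_def indicator_def)
    qed
    finally show False using close gnorm C[OF t] by (simp add: u_def)
  qed
  then show ?thesis using f by (intro bexI[of _ "Lp_eq v p `` {f}"]) (auto simp: Lp_space_def quotientI)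
qed


lemma borel_measurable_continuous_halfline:
  fixes g :: "real \<Rightarrow> real"
  assumes "continuous_on UNIV g"
  shows "g \<in> borel_measurable halfline"
  by (rule continuous_imp_measurable_on_sets_lebesgue[OF continuous_on_subset[OF assms]]) auto

lemma Lp_fun_continuous_support:
  assumes v: "admissible_weight v" and p: "0 < p"
    and g: "continuous_on UNIV g" and supp: "\<And>x. b < x \<Longrightarrow> g x = 0" and b: "0 \<le> b"
  shows "restrict g {0..} \<in> Lp_fun v p"
proof -
  have "compact (g ` {0..b})"
    using continuous_on_subset[OF g] by (intro compact_continuous_image) auto
  then have "bounded (g ` {0..b})" by (rule compact_imp_bounded)
  then obtain B where B: "0 < B" "\<forall>z\<in>g ` {0..b}. norm z \<le> B"
    unfolding bounded_pos by blast
  show ?thesis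
  proof (rule Lp_fun_bounded_support(1)[OF v p b borel_measurable_continuous_halfline[OF g] _ supp])
    show "\<bar>g x\<bar> \<le> B" if "0 \<le> x" for x
      using B supp[of x] that by (cases "x \<le> b") auto
  qed
qed

text \<open>
  Truncation of values at \<open>\<plusminus>K\<close>; it provides the dominating functions for the density argument.
\<close>

definition clip :: "real \<Rightarrow> real \<Rightarrow> real" where
  "clip K y = max (- K) (min K y)"

lemma clip_bounds: "0 \<le> K \<Longrightarrow> \<bar>clip K y\<bar> \<le> K"
  by (auto simp: clip_def)

lemma continuous_clip: "continuous_on S (clip K)"
  unfolding clip_def by (intro continuous_intros)

lemma scaled_clip_error:
  assumes "0 \<le> c" "c \<le> 1" "0 \<le> K"
  shows "\<bar>y - c * clip K y\<bar> \<le> \<bar>y\<bar>"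
proof (cases "0 \<le> y")
  case True
  then have "0 \<le> clip K y" "clip K y \<le> y" using assms by (auto simp: clip_def)
  then have "0 \<le> c * clip K y" "c * clip K y \<le> 1 * y"
    using assms mult_mono[of c 1 "clip K y" y] by auto
  then show ?thesis using True by simp
next
  case False
  then have "0 \<le> - clip K y" "- clip K y \<le> - y" using assms by (auto simp: clip_def)
  then have "0 \<le> c * (- clip K y)" "c * (- clip K y) \<le> 1 * (- y)"
    using assms mult_mono[of c 1 "- clip K y" "- y"]
    by (auto simp: mult_nonneg_nonpos)
  then show ?thesis using False by simp
qed

lemma powr_diff_le:
  fixes a b p :: real
  assumes p: "0 \<le> p"
  shows "\<bar>a - b\<bar> powr p \<le> 2 powr p * (\<bar>a\<bar> powr p + \<bar>b\<bar> powr p)"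
proof -
  let ?m = "max \<bar>a\<bar> \<bar>b\<bar>"
  have "\<bar>a - b\<bar> powr p \<le> (2 * ?m) powr p"
    using p by (intro powr_mono2) auto
  also have "\<dots> = 2 powr p * ?m powr p"
    by (simp add: powr_mult)
  also have "?m powr p \<le> \<bar>a\<bar> powr p + \<bar>b\<bar> powr p"
    by (auto simp: max_def)
  finally show ?thesis by simp
qed

text \<open>
  A measurable function is almost everywhere a limit of continuous functions \<open>g n\<close>, but without
  any domination. Dominated convergence is therefore applied twice: first truncation and cut-off of
  \<open>G\<close> itself at level \<open>k\<close> converge to \<open>G\<close>, with an error dominated by \<open>\<bar>G\<bar>\<close>; then, for fixed \<open>k\<close>, the same
  truncation and cut-off of \<open>g n\<close> converge, dominated because they are bounded with bounded support.
\<close>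

lemma Lp_continuous_dense:
  assumes v: "admissible_weight v" and p: "1 \<le> p" and G: "G \<in> Lp_fun v p" and e: "0 < e"
  shows "\<exists>k g. continuous_on UNIV g \<and> Lp_int v p (\<lambda>x. G x - plateau k x * g x) < e"
proof -
  have Gm: "G \<in> borel_measurable halfline"
    and Gi: "integrable halfline (\<lambda>x. \<bar>G x\<bar> powr p * v x)"
    using G by (auto simp: Lp_fun_def)
  note [measurable] = Gm admissible_weight_measurable[OF v]
  have clip_meas: "clip K \<in> borel_measurable borel" for K
    by (rule borel_measurable_continuous_onI[OF continuous_clip])
  have pl [measurable]: "plateau k \<in> borel_measurable halfline" for k
    by (rule borel_measurable_continuous_halfline[OF continuous_on_plateau])
  have cl [measurable]: "(\<lambda>x. clip K (h x)) \<in> borel_measurable halfline"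
    if "h \<in> borel_measurable halfline" for K h
    using measurable_compose[OF that clip_meas] .
  have vn: "0 \<le> v x" if "0 \<le> x" for x
    using admissible_weight_pos[OF v that] by simp
  have "(\<lambda>k. Lp_int v p (\<lambda>x. G x - plateau k x * clip (real k) (G x))) \<longlonglongrightarrow> (\<integral>x. 0 \<partial>halfline)"
    unfolding Lp_int_def
  proof (rule integral_dominated_convergence)
    show "integrable halfline (\<lambda>x. \<bar>G x\<bar> powr p * v x)" by (rule Gi)
    show "(\<lambda>x. \<bar>G x - plateau k x * clip (real k) (G x)\<bar> powr p * v x) \<in> borel_measurable halfline" for k
      using cl[OF Gm] by measurable
    show "AE x in halfline. norm (\<bar>G x - plateau k x * clip (real k) (G x)\<bar> powr p * v x)
        \<le> \<bar>G x\<bar> powr p * v x" for k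
    proof (rule AE_I2)
      fix x assume "x \<in> space halfline"
      then have x: "0 \<le> x" by simp
      have "\<bar>G x - plateau k x * clip (real k) (G x)\<bar> powr p * v x \<le> \<bar>G x\<bar> powr p * v x"
        using p vn[OF x] plateau_bounds[of k x]
        by (intro mult_right_mono powr_mono2 scaled_clip_error) auto
      then show "norm (\<bar>G x - plateau k x * clip (real k) (G x)\<bar> powr p * v x) \<le> \<bar>G x\<bar> powr p * v x"
        using vn[OF x] by (simp add: abs_mult)
    qed
    show "AE x in halfline. (\<lambda>k. \<bar>G x - plateau k x * clip (real k) (G x)\<bar> powr p * v x) \<longlonglongrightarrow> 0"
    proof (rule AE_I2)
      fix x assume "x \<in> space halfline"
      then have x: "0 \<le> x" by simp
      show "(\<lambda>k. \<bar>G x - plateau k x * clip (real k) (G x)\<bar> powr p * v x) \<longlonglongrightarrow> 0"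
      proof (rule tendsto_eventually)
        show "\<forall>\<^sub>F k in sequentially. \<bar>G x - plateau k x * clip (real k) (G x)\<bar> powr p * v x = 0"
          using eventually_ge_at_top[of "nat \<lceil>max x \<bar>G x\<bar>\<rceil>"]
        proof eventually_elim
          fix k assume "nat \<lceil>max x \<bar>G x\<bar>\<rceil> \<le> k"
          then have "x \<le> real k" "\<bar>G x\<bar> \<le> real k" by linarith+
          then have "plateau k x = 1" "clip (real k) (G x) = G x"
            using x by (auto simp: plateau_eq_1 clip_def)
          then show "\<bar>G x - plateau k x * clip (real k) (G x)\<bar> powr p * v x = 0" by simp
        qed
      qed
    qed
  qed simp
  then have "\<forall>\<^sub>F k in sequentially. Lp_int v p (\<lambda>x. G x - plateau k x * clip (real k) (G x)) < e"
    by (rule order_tendstoD) (use e in simp)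
  then obtain k :: nat where k: "Lp_int v p (\<lambda>x. G x - plateau k x * clip (real k) (G x)) < e"
    by (auto simp: eventually_sequentially)
  have "G measurable_on {0..}"
    using Gm by (subst measurable_on_iff_borel_measurable) auto
  then obtain Z g where Z: "negligible Z" and g: "\<And>n. continuous_on UNIV (g n)"
    and lim: "\<And>x. x \<notin> Z \<Longrightarrow> (\<lambda>n. g n x) \<longlonglongrightarrow> (if x \<in> {0..} then G x else 0)"
    unfolding measurable_on_def by blast
  have gm: "g n \<in> borel_measurable halfline" for n
    by (rule borel_measurable_continuous_halfline[OF g])
  have "Z \<in> null_sets lebesgue" using Z by (simp add: negligible_iff_null_sets)
  then have "AE x in lebesgue. x \<notin> Z" by (rule AE_not_in)
  then have "AE x in lebesgue. x \<in> {0..} \<longrightarrow> (\<lambda>n. g n x) \<longlonglongrightarrow> G x"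
    by eventually_elim (use lim in fastforce)
  then have ae: "AE x in halfline. (\<lambda>n. g n x) \<longlonglongrightarrow> G x"
    by (simp add: AE_restrict_space_iff)
  let ?W = "\<lambda>x. 2 powr p * (\<bar>G x\<bar> powr p * v x + real k powr p * (indicator {0..real k + 1} x * v x))"
  have "(\<lambda>n. Lp_int v p (\<lambda>x. G x - plateau k x * clip (real k) (g n x))) \<longlonglongrightarrow>
      Lp_int v p (\<lambda>x. G x - plateau k x * clip (real k) (G x))"
    unfolding Lp_int_def
  proof (rule integral_dominated_convergence)
    show "integrable halfline ?W"
      by (intro integrable_mult_right Bochner_Integration.integrable_add Gi integrable_weight_interval v) simp
    show "(\<lambda>x. \<bar>G x - plateau k x * clip (real k) (G x)\<bar> powr p * v x) \<in> borel_measurable halfline"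
      using cl[OF Gm] by measurable
    show "(\<lambda>x. \<bar>G x - plateau k x * clip (real k) (g n x)\<bar> powr p * v x) \<in> borel_measurable halfline" for n
      using cl[OF gm] by measurable
    show "AE x in halfline. norm (\<bar>G x - plateau k x * clip (real k) (g n x)\<bar> powr p * v x) \<le> ?W x" for n
    proof (rule AE_I2)
      fix x assume "x \<in> space halfline"
      then have x: "0 \<le> x" by simp
      have "\<bar>plateau k x * clip (real k) (g n x)\<bar> powr p \<le> real k powr p * indicator {0..real k + 1} x"
      proof (cases "plateau k x = 0")
        case True
        then show ?thesis using p by simp
      next
        case False
        have "\<bar>plateau k x * clip (real k) (g n x)\<bar> \<le> 1 * real k"
          unfolding abs_mult using plateau_bounds[of k x] by (intro mult_mono clip_bounds) auto
        then have "\<bar>plateau k x * clip (real k) (g n x)\<bar> powr p \<le> real k powr p"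
          using p by (intro powr_mono2) auto
        then show ?thesis using plateau_support[OF False] x by simp
      qed
      then have "\<bar>G x - plateau k x * clip (real k) (g n x)\<bar> powr p
          \<le> 2 powr p * (\<bar>G x\<bar> powr p + real k powr p * indicator {0..real k + 1} x)"
        using p by (intro order_trans[OF powr_diff_le] mult_left_mono add_left_mono) auto
      then have "\<bar>G x - plateau k x * clip (real k) (g n x)\<bar> powr p * v x
          \<le> 2 powr p * (\<bar>G x\<bar> powr p + real k powr p * indicator {0..real k + 1} x) * v x"
        using vn[OF x] by (rule mult_right_mono)
      then show "norm (\<bar>G x - plateau k x * clip (real k) (g n x)\<bar> powr p * v x) \<le> ?W x"
        using vn[OF x] by (simp add: abs_mult algebra_simps)
    qed
    show "AE x in halfline. (\<lambda>n. \<bar>G x - plateau k x * clip (real k) (g n x)\<bar> powr p * v x) \<longlonglongrightarrow>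
        \<bar>G x - plateau k x * clip (real k) (G x)\<bar> powr p * v x"
      using ae
    proof eventually_elim
      fix x assume "(\<lambda>n. g n x) \<longlonglongrightarrow> G x"
      then have "(\<lambda>n. \<bar>G x - plateau k x * clip (real k) (g n x)\<bar>) \<longlonglongrightarrow>
          \<bar>G x - plateau k x * clip (real k) (G x)\<bar>"
        unfolding clip_def by (intro tendsto_intros)
      then show "(\<lambda>n. \<bar>G x - plateau k x * clip (real k) (g n x)\<bar> powr p * v x) \<longlonglongrightarrow>
          \<bar>G x - plateau k x * clip (real k) (G x)\<bar> powr p * v x"
        using p by (intro tendsto_mult_right tendsto_powr') auto
    qed
  qed
  then have "\<forall>\<^sub>F n in sequentially. Lp_int v p (\<lambda>x. G x - plateau k x * clip (real k) (g n x)) < e"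
    by (rule order_tendstoD(2)) (rule k)
  then obtain n where n: "Lp_int v p (\<lambda>x. G x - plateau k x * clip (real k) (g n x)) < e"
    by (auto simp: eventually_sequentially)
  have "continuous_on UNIV (\<lambda>x. clip (real k) (g n x))"
    by (rule continuous_on_compose2[OF continuous_clip[of UNIV] g]) simp
  with n show ?thesis by blast
qed

text \<open>
  The weighted \<open>p\<close>-th power of \<open>u\<close> is dominated by a sum over \<open>m > n\<close> of multiples of
  characteristic functions of intervals of length \<open>b m + 1\<close>, and the integral of that sum is at most \<open>\<Sum>\<^sub>m\<^sub>>\<^sub>n 2\<^sup>-\<^sup>m = 2\<^sup>-\<^sup>n\<close>.
\<close>

lemma Lp_fun_bump_series:
  fixes b s :: "nat \<Rightarrow> real"
  assumes v: "admissible_weight v" and b: "\<And>m. 0 \<le> b m" and u: "u \<in> borel_measurable halfline"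
    and bump: "\<And>y. 0 \<le> y \<Longrightarrow> u y = 0 \<or> (\<exists>m>n. s m - r - 1 \<le> y \<and> y \<le> s m - r + b m \<and>
           \<bar>u y\<bar> powr p * v y \<le> (1 / 2) ^ m / (b m + 1))"
  shows "restrict u {0..} \<in> Lp_fun v p" "Lp_int v p u \<le> (1 / 2) ^ n"
proof -
  define I where "I i = {s (n + 1 + i) - r - 1..s (n + 1 + i) - r + b (n + 1 + i)}" for i
  define c where "c i = (1 / 2) ^ (n + 1 + i) / (b (n + 1 + i) + 1)" for i
  have c0: "0 \<le> c i" for i using b[of "n + 1 + i"] by (simp add: c_def)
  note [measurable] = u admissible_weight_measurable[OF v]
  have le: "ennreal (\<bar>u y\<bar> powr p * v y) \<le> (\<Sum>i. ennreal (c i) * indicator (I i) y)"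
    if y: "0 \<le> y" for y
    using bump[OF y]
  proof
    assume "u y = 0"
    then show ?thesis by simp
  next
    assume "\<exists>m>n. s m - r - 1 \<le> y \<and> y \<le> s m - r + b m \<and>
           \<bar>u y\<bar> powr p * v y \<le> (1 / 2) ^ m / (b m + 1)"
    then obtain m where m: "n < m" "s m - r - 1 \<le> y" "y \<le> s m - r + b m"
      "\<bar>u y\<bar> powr p * v y \<le> (1 / 2) ^ m / (b m + 1)" by blast
    define i where "i = m - (n + 1)"
    have mi: "n + 1 + i = m" using m by (simp add: i_def)
    have "ennreal (\<bar>u y\<bar> powr p * v y) \<le> ennreal (c i) * indicator (I i) y"
      unfolding I_def c_def mi using m by (simp add: ennreal_leI)
    also have "\<dots> = (\<Sum>j\<in>{i}. ennreal (c j) * indicator (I j) y)"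
      by (simp only: sum.insert sum.empty finite.emptyI empty_iff not_False_eq_True add_0_right)
    also have "\<dots> \<le> (\<Sum>j. ennreal (c j) * indicator (I j) y)"
      by (rule sum_le_suminf) auto
    finally show ?thesis .
  qed
  have "(\<integral>\<^sup>+y. ennreal (\<bar>u y\<bar> powr p * v y) \<partial>halfline)
      \<le> (\<integral>\<^sup>+y. (\<Sum>i. ennreal (c i) * indicator (I i) y) \<partial>halfline)"
    by (rule nn_integral_mono) (use le in auto)
  also have "\<dots> = (\<integral>\<^sup>+y. (\<Sum>i. ennreal (c i) * indicator (I i) y) * indicator {0..} y \<partial>lebesgue)"
    by (rule nn_integral_restrict_space) simp
  also have "\<dots> \<le> (\<integral>\<^sup>+y. (\<Sum>i. ennreal (c i) * indicator (I i) y) \<partial>lebesgue)"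
    by (rule nn_integral_mono) (auto simp: indicator_def)
  also have "\<dots> = (\<Sum>i. \<integral>\<^sup>+y. ennreal (c i) * indicator (I i) y \<partial>lebesgue)"
  proof (rule nn_integral_suminf)
    fix i
    have "I i \<in> sets lebesgue" by (simp add: I_def)
    then show "(\<lambda>y. ennreal (c i) * indicator (I i) y) \<in> borel_measurable lebesgue"
      by (intro borel_measurable_times_ennreal borel_measurable_indicator) auto
  qed
  also have "\<dots> = (\<Sum>i. ennreal ((1 / 2) ^ (n + 1 + i)))"
  proof (rule suminf_cong)
    fix i
    have "(\<integral>\<^sup>+y. ennreal (c i) * indicator (I i) y \<partial>lebesgue) = ennreal (c i) * emeasure lebesgue (I i)"
      by (rule nn_integral_cmult_indicator) (simp add: I_def)
    also have "emeasure lebesgue (I i) = ennreal (b (n + 1 + i) + 1)"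
      using b[of "n + 1 + i"] by (simp add: I_def)
    also have "ennreal (c i) * ennreal (b (n + 1 + i) + 1) = ennreal (c i * (b (n + 1 + i) + 1))"
      using c0 b[of "n + 1 + i"] by (simp add: ennreal_mult)
    also have "c i * (b (n + 1 + i) + 1) = (1 / 2) ^ (n + 1 + i)"
    proof -
      have "b (n + 1 + i) + 1 \<noteq> 0" using b[of "n + 1 + i"] by linarith
      then show ?thesis unfolding c_def by (rule nonzero_eq_divide_eq[THEN iffD1, OF _ refl])
    qed
    finally show "(\<integral>\<^sup>+y. ennreal (c i) * indicator (I i) y \<partial>lebesgue) = ennreal ((1 / 2) ^ (n + 1 + i))" .
  qed
  also have "\<dots> = ennreal ((1 / 2) ^ n)"
  proof -
    have "(\<lambda>i. (1 / 2 :: real) ^ (n + 1) * (1 / 2) ^ i) sums ((1 / 2) ^ (n + 1) * (1 / (1 - 1 / 2)))"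
      by (intro sums_mult geometric_sums) simp
    then have "(\<lambda>i. (1 / 2 :: real) ^ (n + 1 + i)) sums ((1 / 2) ^ n)"
      by (simp add: power_add)
    then show ?thesis
      by (intro suminf_ennreal_eq) auto
  qed
  finally have bound: "(\<integral>\<^sup>+y. ennreal (\<bar>u y\<bar> powr p * v y) \<partial>halfline) \<le> ennreal ((1 / 2) ^ n)" .
  then have "integrable halfline (\<lambda>y. \<bar>u y\<bar> powr p * v y)"
  proof (intro integrableI_nonneg)
    show "AE y in halfline. 0 \<le> \<bar>u y\<bar> powr p * v y"
    proof (rule AE_I2)
      fix y assume "y \<in> space halfline"
      then show "0 \<le> \<bar>u y\<bar> powr p * v y" using admissible_weight_pos[OF v, of y] by simp
    qed
    show "(\<integral>\<^sup>+y. ennreal (\<bar>u y\<bar> powr p * v y) \<partial>halfline) < \<infinity>"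
      using bound by (rule le_less_trans) simp
  qed measurable
  then show "restrict u {0..} \<in> Lp_fun v p" using u by (simp add: restrict_Lp_fun_iff)
  show "Lp_int v p u \<le> (1 / 2) ^ n"
    unfolding Lp_int_def by (rule integral_real_bounded[OF _ bound]) simp
qed

text \<open>
  Again three approximations: by a continuous function times a plateau, by a test function, and by a
  translate of the universal function. Each contributes less than \<open>e / 3\<close> to the norm, that is, less
  than \<open>d = (e / 3)\<^sup>p\<close> to the integral.
\<close>

lemma Lp_hypercyclic_if_null_liminf:
  assumes v: "admissible_weight v" and p: "1 \<le> p" and nl: "null_liminf v"
  shows "hypercyclic (Lp_topology v p) (Lp_translation v p)"
proof -
  obtain f s where f: "continuous_on UNIV f" and s0: "s 0 = 0"
    and gap: "\<And>m. s m + test_end m + 2 \<le> s (Suc m)"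
    and err: "\<And>n y. 0 \<le> y \<Longrightarrow> f (y + s n) = test_seq n y \<or> 
        (\<exists>m>n. s m - s n - 1 \<le> y \<and> y \<le> s m - s n + test_end m \<and>
           \<bar>f (y + s n) - test_seq n y\<bar> powr p * v y \<le> (1 / 2) ^ m / (test_end m + 1))"
  proof (rule universal_function[OF v nl, of test_seq test_end p])
    show "- 1 \<le> y \<and> y \<le> test_end m" if "test_seq m y \<noteq> 0" for m y
      using that by (rule test_seq_support)
    show "0 \<le> p" using p by simp
  qed (rule continuous_on_test_seq test_end_nonneg that; assumption)+
  have "s m \<le> s (Suc m)" for m
    using gap[of m] test_end_nonneg[of m] by linarith
  then have mono: "s m \<le> s n" if "m \<le> n" for m n
    using that by (rule lift_Suc_mono_le)
  have t: "0 \<le> s n" for n using mono[of 0 n] s0 by simp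
  have p0: "0 < p" using p by simp
  have cont: "continuous_on UNIV (\<lambda>y. f (y + s n))" for n
    by (rule continuous_on_compose2[OF f]) (auto intro!: continuous_intros)
  have E: "restrict (\<lambda>y. f (y + s n) - test_seq n y) {0..} \<in> Lp_fun v p"
      "Lp_int v p (\<lambda>y. f (y + s n) - test_seq n y) \<le> (1 / 2) ^ n" for n
  proof -
    have m: "(\<lambda>y. f (y + s n) - test_seq n y) \<in> borel_measurable halfline"
      by (intro borel_measurable_continuous_halfline continuous_on_diff cont continuous_on_test_seq)
    have bump: "f (y + s n) - test_seq n y = 0 \<or> (\<exists>m>n. s m - s n - 1 \<le> y \<and> y \<le> s m - s n + test_end m \<and>
           \<bar>f (y + s n) - test_seq n y\<bar> powr p * v y \<le> (1 / 2) ^ m / (test_end m + 1))"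
      if "0 \<le> y" for y
      using err[OF that, of n] by simp
    show "restrict (\<lambda>y. f (y + s n) - test_seq n y) {0..} \<in> Lp_fun v p"
      "Lp_int v p (\<lambda>y. f (y + s n) - test_seq n y) \<le> (1 / 2) ^ n"
      using Lp_fun_bump_series[OF v test_end_nonneg m bump] by auto
  qed
  have F: "restrict f {0..} \<in> Lp_fun v p"
    using E(1)[of 0] by (simp add: s0 test_seq_def)
  have Fs: "restrict (\<lambda>y. f (y + s n)) {0..} \<in> Lp_fun v p" for n
  proof -
    have "left_translation (s n) (restrict f {0..}) = restrict (\<lambda>y. f (y + s n)) {0..}"
      using t[of n] by (auto simp: left_translation_def restrict_def)
    then show ?thesis using left_translation_Lp_fun[OF v t F, of n] by simp
  qed
  have tail_small: "test_seq n x = 0" if "test_end n < x" for n x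
    using test_seq_support[of n x] that by linarith
  have test: "restrict (test_seq n) {0..} \<in> Lp_fun v p" for n
    by (rule Lp_fun_continuous_support[OF v p0 continuous_on_test_seq tail_small test_end_nonneg])
  show ?thesis
    unfolding hypercyclic_Lp_iff[OF v p]
  proof (intro bexI[OF _ F] ballI allI impI)
    fix G and e :: real assume G: "G \<in> Lp_fun v p" and e: "0 < e"
    define d where "d = (e / 3) powr p"
    have d: "0 < d" using e by (simp add: d_def)
    obtain k g where g: "continuous_on UNIV g"
      and Gg: "Lp_int v p (\<lambda>x. G x - plateau k x * g x) < d"
      using Lp_continuous_dense[OF v p G d] by blast
    define A where "A = (\<integral>x. indicator {0..real k + 1} x * v x \<partial>halfline)"
    have A: "0 \<le> A"
      unfolding A_def
    proof (rule integral_nonneg_AE, rule AE_I2)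
      fix x assume "x \<in> space halfline"
      then show "0 \<le> indicator {0..real k + 1} x * v x"
        using admissible_weight_pos[OF v, of x] by simp
    qed
    \<comment> \<open>A uniform error \<open>\<delta>\<close> on the support costs \<open>\<delta>\<^sup>p A\<close>; adding \<open>1\<close> avoids a
      separate case for \<open>A = 0\<close>.\<close>
    define \<delta> where "\<delta> = (d / (A + 1)) powr (1 / p)"
    have \<delta>: "0 < \<delta>" using d A by (simp add: \<delta>_def)
    have \<delta>A: "\<delta> powr p * A < d"
    proof -
      have "\<delta> powr p = d / (A + 1)" using d A p by (simp add: \<delta>_def powr_powr)
      then have "\<delta> powr p * (A + 1) = d" using A by simp
      moreover have "0 < \<delta> powr p" using \<delta> by simp
      ultimately show ?thesis unfolding distrib_left by linarith
    qed
    obtain j where j: "(1 / 2) ^ j < d" using real_arch_pow_inv[OF d, of "1/2"] by auto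
    obtain n where n: "j \<le> n" "\<And>x. \<bar>plateau k x * g x - test_seq n x\<bar> \<le> \<delta> * plateau k x"
      using test_seq_dense[OF g \<delta>, of j k] by blast
    have supp: "plateau k x = 0" if "real k + 1 < x" for x
      using plateau_support[of k x] that by linarith
    have pg: "restrict (\<lambda>x. plateau k x * g x) {0..} \<in> Lp_fun v p"
    proof (rule Lp_fun_continuous_support[OF v p0])
      show "continuous_on UNIV (\<lambda>x. plateau k x * g x)"
        by (intro continuous_on_mult continuous_on_plateau g)
      show "plateau k x * g x = 0" if "real k + 1 < x" for x using supp[OF that] by simp
    qed simp
    have 1: "Lp_fun_norm v p (\<lambda>x. G x - plateau k x * g x) < e / 3"
      by (rule Lp_fun_norm_less[OF v p]) (use Gg e in \<open>auto simp: d_def\<close>)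
    have "Lp_int v p (\<lambda>x. plateau k x * g x - test_seq n x) \<le> \<delta> powr p * A"
      unfolding A_def
    proof (rule Lp_fun_bounded_support(2)[OF v p0])
      show "(\<lambda>x. plateau k x * g x - test_seq n x) \<in> borel_measurable halfline"
        by (intro borel_measurable_continuous_halfline continuous_on_diff continuous_on_mult
            continuous_on_plateau g continuous_on_test_seq)
      show "\<bar>plateau k x * g x - test_seq n x\<bar> \<le> \<delta>" for x
        using n(2)[of x] plateau_bounds(2)[of k x] \<delta> mult_left_mono[of "plateau k x" 1 \<delta>] by linarith
      show "plateau k x * g x - test_seq n x = 0" if "real k + 1 < x" for x
        using n(2)[of x] supp[OF that] by simp
    qed simp
    then have 2: "Lp_fun_norm v p (\<lambda>x. plateau k x * g x - test_seq n x) < e / 3"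
      by (intro Lp_fun_norm_less[OF v p]) (use \<delta>A e in \<open>auto simp: d_def\<close>)
    have "Lp_int v p (\<lambda>x. test_seq n x - f (x + s n)) < d"
    proof -
      have "Lp_int v p (\<lambda>x. test_seq n x - f (x + s n)) = Lp_int v p (\<lambda>x. f (x + s n) - test_seq n x)"
        by (simp add: Lp_int_def abs_minus_commute)
      moreover have "(1 / 2 :: real) ^ n \<le> (1 / 2) ^ j" using n by (intro power_decreasing) auto
      ultimately show ?thesis using E(2)[of n] j by linarith
    qed
    then have 3: "Lp_fun_norm v p (\<lambda>x. test_seq n x - f (x + s n)) < e / 3"
      by (intro Lp_fun_norm_less[OF v p]) (use e in \<open>auto simp: d_def\<close>)
    have G': "restrict G {0..} \<in> Lp_fun v p" using G by (simp add: restrict_Lp_fun)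
    have "Lp_fun_norm v p (\<lambda>x. G x - f (x + s n)) < e"
      using Lp_fun_norm_triangle[OF v p G' pg Fs[of n]]
        Lp_fun_norm_triangle[OF v p pg test[of n] Fs[of n]] 1 2 3 by linarith
    moreover have "Lp_fun_norm v p (\<lambda>x. G x - restrict f {0..} (x + s n)) =
        Lp_fun_norm v p (\<lambda>x. G x - f (x + s n))"
      by (rule Lp_fun_norm_cong_halfline) (use t[of n] in simp)
    ultimately show "\<exists>t\<ge>0. Lp_fun_norm v p (\<lambda>x. G x - restrict f {0..} (x + t)) < e"
      using t[of n] by (intro exI[of _ "s n"]) simp
  qed
qed

section \<open>The characterization of hypercyclicity\<close>

theorem theorem3p1:
  fixes v :: "real \<Rightarrow> real"
  assumes "admissible_weight v"
  shows "(\<forall>p\<ge>1. hypercyclic (Lp_topology v p) (Lp_translation v p) \<longleftrightarrow>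
             (\<exists>F\<in>Lp_space v p. \<exists>a>0.
                \<not> ((\<lambda>t. Lp_norm v p (Lp_cutoff v p a (Lp_translation v p t F))) \<longlongrightarrow> 0) at_top)) \<and>
         (hypercyclic (C0_topology v) left_translation \<longleftrightarrow>
             (\<exists>f\<in>C0_space v. \<exists>a>0.
                \<not> ((\<lambda>t. C0_norm v (cutoff a (left_translation t f))) \<longlongrightarrow> 0) at_top))"
proof (intro conjI allI impI)
  have C0_null: "null_liminf v"
    if "f \<in> C0_space v" "0 < a"
      "\<not> ((\<lambda>t. C0_norm v (cutoff a (left_translation t f))) \<longlongrightarrow> 0) at_top" for f a
    using bounded_below_if_not_null_liminf[OF assms] C0_cutoff_tendsto_0[OF assms _ _ that(1)] that(2,3)
    by (metis less_imp_le)
  show "hypercyclic (C0_topology v) left_translation \<longleftrightarrow>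
      (\<exists>f\<in>C0_space v. \<exists>a>0.
         \<not> ((\<lambda>t. C0_norm v (cutoff a (left_translation t f))) \<longlongrightarrow> 0) at_top)"
    using C0_hypercyclic_imp_not_tendsto[OF assms] C0_hypercyclic_if_null_liminf[OF assms] C0_null
    by (meson zero_less_one)
next
  fix p :: real assume p: "1 \<le> p"
  have Lp_null: "null_liminf v"
    if "F \<in> Lp_space v p"
      "\<not> ((\<lambda>t. Lp_norm v p (Lp_cutoff v p a (Lp_translation v p t F))) \<longlongrightarrow> 0) at_top" for F a
    using bounded_below_if_not_null_liminf[OF assms] Lp_cutoff_tendsto_0[OF assms p _ _ that(1)] that(2)
    by metis
  show "hypercyclic (Lp_topology v p) (Lp_translation v p) \<longleftrightarrow>
      (\<exists>F\<in>Lp_space v p. \<exists>a>0.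
         \<not> ((\<lambda>t. Lp_norm v p (Lp_cutoff v p a (Lp_translation v p t F))) \<longlongrightarrow> 0) at_top)"
    using Lp_hypercyclic_imp_not_tendsto[OF assms p] Lp_hypercyclic_if_null_liminf[OF assms p] Lp_null
    by (meson zero_less_one)
qed

end
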